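(* Let $n\ge 2$ and let $\Delta\subset\mathbb{R}^n$ be a simplex that is a maximal lattice-free convex body and such that each facet of $\Delta$ has exactly one integer point in its relative interior. Then $\Delta$ is a body with a unique lifting for all $f\in\operatorname{int}(\Delta)$ if and only if $\Delta$ is an affine unimodular transformation of $\operatorname{conv}\{0,ne^1,\ldots,ne^n\}$.
   Context: $e^1,\ldots,e^n$ are the standard unit vectors of $\mathbb{R}^n$. An affine unimodular transformation of $\mathbb{R}^n$ is a map $x\mapsto Ux+t$ with $U\in GL_n(\mathbb{Z})$ (integer matrix with determinant $\pm1$) and $t\in\mathbb{Z}^n$. A lattice-free convex set in $\mathbb{R}^n$ is a convex set containing no point of $\mathbb{Z}^n$ in its interior; it is maximal if it is not properly contained in another lattice-free convex set. A maximal lattice-free convex body is a compact, full-dimensional maximal lattice-free convex set. Let $f\in\mathbb{R}^n\setminus\mathbb{Z}^n$. A function $\psi:\mathbb{R}^n\to\mathbb{R}_+$ is valid for the continuous infinite relaxation if $\sum_r\psi(r)s_r\ge 1$ for every finitely supported $s:\mathbb{R}^n\to\mathbb{R}_+$ with $f+\sum_r r s_r\in\mathbb{Z}^n$. A function $\pi:\mathbb{R}^n\to\mathbb{R}_+$ is valid for the integer infinite relaxation if $\sum_r\pi(r)s_r\ge 1$ for every finitely supported $s:\mathbb{R}^n\to\mathbb{Z}_+$ with $f+\sum_r r s_r\in\mathbb{Z}^n$. Given $\psi$ valid for the continuous relaxation, a lifting of $\psi$ is a function $\pi\le\psi$ (pointwise) that is valid for the integer relaxation; a minimal lifting is a lifting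 $\pi$ such that no lifting $\pi'\ne\pi$ satisfies $\pi'\le\pi$ pointwise. Given a maximal lattice-free convex body $B$ and $f\in\operatorname{int}(B)$, write uniquely $B=\{x\in\mathbb{R}^n : a^i\cdot(x-f)\le 1,\ i\in I\}$ with $I$ finite and every inequality facet-defining, and set $\psi(r)=\max_{i\in I}a^i\cdot r$ (the gauge of $B-f$), which is valid for the continuous relaxation. $B$ is a body with a unique lifting for all $f\in\operatorname{int}(B)$ if for every $f\in\operatorname{int}(B)$ the corresponding $\psi$ has a unique minimal lifting. *)

theory Defs
  imports "HOL-Analysis.Analysis"
begin

definition integer_points :: "(real ^ 'n) set" where
  "integer_points = {x. \<forall>i. x $ i \<in> \<int>}"

definition lattice_free :: "(real ^ 'n) set \<Rightarrow> bool" where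
  "lattice_free S \<longleftrightarrow> convex S \<and> interior S \<inter> integer_points = {}"

definition maximal_lattice_free :: "(real ^ 'n) set \<Rightarrow> bool" where
  "maximal_lattice_free S \<longleftrightarrow> lattice_free S \<and> \<not> (\<exists>T. lattice_free T \<and> S \<subset> T)"

definition maximal_lattice_free_body :: "(real ^ 'n) set \<Rightarrow> bool" where
  "maximal_lattice_free_body B \<longleftrightarrow>
     maximal_lattice_free B \<and> compact B \<and> aff_dim B = int CARD('n)"


definition valid_continuous :: "real ^ 'n \<Rightarrow> (real ^ 'n \<Rightarrow> real) \<Rightarrow> bool" where
  "valid_continuous f \<psi> \<longleftrightarrow>
     (\<forall>r. 0 \<le> \<psi> r) \<and>
     (\<forall>s :: real ^ 'n \<Rightarrow> real.
        (\<forall>r. 0 \<le> s r) \<longrightarrow> finite {r. s r \<noteq> 0} \<longrightarrow>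
        f + (\<Sum>r | s r \<noteq> 0. s r *\<^sub>R r) \<in> integer_points \<longrightarrow>
        1 \<le> (\<Sum>r | s r \<noteq> 0. \<psi> r * s r))"

definition valid_integer :: "real ^ 'n \<Rightarrow> (real ^ 'n \<Rightarrow> real) \<Rightarrow> bool" where
  "valid_integer f \<pi> \<longleftrightarrow>
     (\<forall>r. 0 \<le> \<pi> r) \<and>
     (\<forall>s :: real ^ 'n \<Rightarrow> nat.
        finite {r. s r \<noteq> 0} \<longrightarrow>
        f + (\<Sum>r | s r \<noteq> 0. real (s r) *\<^sub>R r) \<in> integer_points \<longrightarrow>
        1 \<le> (\<Sum>r | s r \<noteq> 0. \<pi> r * real (s r)))"

definition lifting :: "real ^ 'n \<Rightarrow> (real ^ 'n \<Rightarrow> real) \<Rightarrow> (real ^ 'n \<Rightarrow> real) \<Rightarrow> bool" where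
  "lifting f \<psi> \<pi> \<longleftrightarrow>
     valid_continuous f \<psi> \<and> valid_integer f \<pi> \<and> (\<forall>r. \<pi> r \<le> \<psi> r)"

definition minimal_lifting ::
    "real ^ 'n \<Rightarrow> (real ^ 'n \<Rightarrow> real) \<Rightarrow> (real ^ 'n \<Rightarrow> real) \<Rightarrow> bool" where
  "minimal_lifting f \<psi> \<pi> \<longleftrightarrow>
     lifting f \<psi> \<pi> \<and>
     \<not> (\<exists>\<pi>'. lifting f \<psi> \<pi>' \<and> \<pi>' \<noteq> \<pi> \<and> (\<forall>r. \<pi>' r \<le> \<pi> r))"


text \<open>
  The finite family of vectors describing \<open>B\<close> around \<open>f\<close> is encoded as the set of these
  vectors. It is unique, and exists for every full-dimensional polyhedron \<open>B\<close> with \<open>f\<close> in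
  its interior; see the two lemmas below.
\<close>

definition facet_description :: "real ^ 'n \<Rightarrow> (real ^ 'n) set \<Rightarrow> (real ^ 'n) set \<Rightarrow> bool" where
  "facet_description f B A \<longleftrightarrow>
     finite A \<and>
     B = {x. \<forall>a\<in>A. a \<bullet> (x - f) \<le> 1} \<and>
     (\<forall>a\<in>A. {x \<in> B. a \<bullet> (x - f) = 1} facet_of B)"

definition facet_vectors :: "real ^ 'n \<Rightarrow> (real ^ 'n) set \<Rightarrow> (real ^ 'n) set" where
  "facet_vectors f B = (THE A. facet_description f B A)"

definition body_gauge :: "real ^ 'n \<Rightarrow> (real ^ 'n) set \<Rightarrow> real ^ 'n \<Rightarrow> real" where
  "body_gauge f B r = Max ((\<lambda>a. a \<bullet> r) ` facet_vectors f B)"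

definition unique_lifting_for_all_f :: "(real ^ 'n) set \<Rightarrow> bool" where
  "unique_lifting_for_all_f B \<longleftrightarrow>
     (\<forall>f \<in> interior B. \<exists>!\<pi>. minimal_lifting f (body_gauge f B) \<pi>)"


definition affine_unimodular :: "(real ^ 'n \<Rightarrow> real ^ 'n) \<Rightarrow> bool" where
  "affine_unimodular T \<longleftrightarrow>
     (\<exists>(U :: real ^ 'n ^ 'n) t.
        (\<forall>i j. U $ i $ j \<in> \<int>) \<and> (det U = 1 \<or> det U = - 1) \<and> t \<in> integer_points \<and>
        T = (\<lambda>x. U *v x + t))"

definition standard_simplex_dilate :: "(real ^ 'n) set" where
  "standard_simplex_dilate =
     convex hull (insert 0 (range (\<lambda>i. real CARD('n) *\<^sub>R axis i 1)))"


lemma facet_description_exists: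
  fixes B :: "(real ^ 'n) set"
  assumes "polyhedron B" and f: "f \<in> interior B"
  shows "\<exists>A. facet_description f B A"
proof -
  have UN: "affine hull B = UNIV"
    using f affine_hull_nonempty_interior by blast
  obtain F where F: "finite F" "B = (affine hull B) \<inter> \<Inter>F"
    "\<forall>h \<in> F. \<exists>a b. a \<noteq> 0 \<and> h = {x. a \<bullet> x \<le> b}"
    "\<forall>F'. F' \<subset> F \<longrightarrow> B \<subset> (affine hull B) \<inter> \<Inter>F'"
    using assms(1) unfolding polyhedron_Int_affine_minimal by blast
  obtain a b where ab: "\<And>h. h \<in> F \<Longrightarrow> a h \<noteq> 0 \<and> h = {x. a h \<bullet> x \<le> b h}"
    using F(3) by metis
  have fc: "\<And>C. C facet_of B \<longleftrightarrow> (\<exists>h. h \<in> F \<and> C = B \<inter> {x. a h \<bullet> x = b h})"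
    using facet_of_polyhedron_explicit[OF F(1,2) ab] F(4) by blast
  have B: "B = \<Inter>F" using F(2) UN by simp
  have pos: "a h \<bullet> f < b h" if "h \<in> F" for h
  proof -
    have "B \<subseteq> {x. a h \<bullet> x \<le> b h}" using B ab[OF that] that by blast
    then have "f \<in> interior {x. a h \<bullet> x \<le> b h}"
      using f interior_mono by blast
    then show ?thesis using interior_halfspace_le[of "a h" "b h"] ab[OF that] by auto
  qed
  define c where "c h = (1 / (b h - a h \<bullet> f)) *\<^sub>R a h" for h
  have c: "c h \<bullet> (x - f) \<le> 1 \<longleftrightarrow> a h \<bullet> x \<le> b h" "c h \<bullet> (x - f) = 1 \<longleftrightarrow> a h \<bullet> x = b h"
    if "h \<in> F" for h x
  proof -
    have "c h \<bullet> (x - f) = (a h \<bullet> x - a h \<bullet> f) / (b h - a h \<bullet> f)"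
      by (simp add: c_def inner_diff_right diff_divide_distrib)
    then show "c h \<bullet> (x - f) \<le> 1 \<longleftrightarrow> a h \<bullet> x \<le> b h" "c h \<bullet> (x - f) = 1 \<longleftrightarrow> a h \<bullet> x = b h"
      using pos[OF that] by (auto simp: pos_divide_le_eq divide_eq_1_iff)
  qed
  have mem: "x \<in> B \<longleftrightarrow> (\<forall>h\<in>F. a h \<bullet> x \<le> b h)" for x
    using B ab by blast
  have "facet_description f B (c ` F)"
    unfolding facet_description_def
  proof (intro conjI ballI)
    show "finite (c ` F)" using F(1) by simp
    show "B = {x. \<forall>a\<in>c ` F. a \<bullet> (x - f) \<le> 1}" using mem c by auto
    fix v assume "v \<in> c ` F"
    then obtain h where h: "h \<in> F" "v = c h" by blast
    have "{x \<in> B. v \<bullet> (x - f) = 1} = B \<inter> {x. a h \<bullet> x = b h}" using h c by auto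
    then show "{x \<in> B. v \<bullet> (x - f) = 1} facet_of B" using fc h by auto
  qed
  then show ?thesis by blast
qed

lemma facet_description_unique:
  fixes B :: "(real ^ 'n) set"
  assumes f: "f \<in> interior B" and "facet_description f B A" "facet_description f B A'"
  shows "A = A'"
proof -
  have sub: "A \<subseteq> A'" if "facet_description f B A" "facet_description f B A'" for A A'
  proof
    fix a assume a: "a \<in> A"
    define G where "G v = {x \<in> B. v \<bullet> (x - f) = 1}" for v
    define H where "H v = {x. v \<bullet> x = 1 + v \<bullet> f}" for v
    note A = that[unfolded facet_description_def, folded G_def]
    have GH: "G v \<subseteq> H v" for v by (auto simp: G_def H_def inner_diff_right)
    have dimB: "aff_dim B = int CARD('n)"
      using f aff_dim_nonempty_interior[of B] by auto
    have Gf: "G v facet_of B" "v \<noteq> 0" "affine hull (G v) = H v"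
      if "v \<in> A \<or> v \<in> A'" for v
    proof -
      show G: "G v facet_of B" using A that by blast
      then have ne: "G v \<noteq> {}" and d: "aff_dim (G v) = int CARD('n) - 1"
        using dimB by (auto simp: facet_of_def)
      show v: "v \<noteq> 0" using ne by (auto simp: G_def)
      show "affine hull (G v) = H v"
      proof (rule affine_dim_equal)
        show "affine (H v)" by (simp add: H_def affine_hyperplane)
        then show "affine hull (G v) \<subseteq> H v" using GH hull_minimal by metis
        show "aff_dim (affine hull (G v)) = aff_dim (H v)"
          using d v by (simp add: H_def aff_dim_hyperplane)
      qed (use ne in auto)
    qed
    have "convex (G a)" "G a \<noteq> {}"
      using Gf(1)[of a] a that
      by (auto simp: facet_of_def dest: face_of_imp_convex)
    then obtain x where x: "x \<in> rel_interior (G a)"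
      using rel_interior_eq_empty by blast
    then have xG: "x \<in> G a" using rel_interior_subset by blast
    have "\<exists>v\<in>A'. v \<bullet> (x - f) = 1"
    proof (rule ccontr)
      assume "\<not> ?thesis"
      moreover have "\<forall>v\<in>A'. v \<bullet> (x - f) \<le> 1" using xG A(2) by (auto simp: G_def)
      ultimately have lt: "\<forall>v\<in>A'. v \<bullet> x < 1 + v \<bullet> f"
        by (force simp: inner_diff_right)
      have "open (\<Inter>v\<in>A'. {y. v \<bullet> y < 1 + v \<bullet> f})"
        using A(2) by (intro open_INT) (auto simp: open_halfspace_lt)
      moreover have "(\<Inter>v\<in>A'. {y. v \<bullet> y < 1 + v \<bullet> f}) \<subseteq> B"
        using A(2) by (fastforce simp: inner_diff_right)
      ultimately have "x \<in> interior B" using lt by (auto intro: interiorI)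
      moreover have "B \<subseteq> {y. a \<bullet> y \<le> 1 + a \<bullet> f}"
        using A(1) a by (force simp: inner_diff_right)
      ultimately have "x \<in> interior {y. a \<bullet> y \<le> 1 + a \<bullet> f}" using interior_mono by blast
      then have "a \<bullet> x < 1 + a \<bullet> f" using Gf(2)[of a] a by simp
      then show False using xG by (simp add: G_def inner_diff_right)
    qed
    then obtain v where v: "v \<in> A'" "v \<bullet> (x - f) = 1" by blast
    have "G a \<subseteq> G v"
    proof (rule subset_of_face_of)
      show "G v face_of B" using Gf(1)[of v] v by (simp add: facet_of_def)
      show "G a \<subseteq> B" by (auto simp: G_def)
      show "G v \<inter> rel_interior (G a) \<noteq> {}" using x xG v by (auto simp: G_def)
    qed
    then have "H a \<subseteq> H v" using Gf(3)[of a] Gf(3)[of v] a v hull_mono by metis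
    moreover have "aff_dim (H a) = aff_dim (H v)"
      using Gf(2) a v by (simp add: H_def aff_dim_hyperplane)
    moreover have "H a \<noteq> {}" using xG GH by blast
    ultimately have eq: "H a = H v"
      by (intro affine_dim_equal) (auto simp: H_def affine_hyperplane)
    have pt: "f + (1 / (u \<bullet> u)) *\<^sub>R u \<in> H u" if "u \<noteq> 0" for u
      using that by (simp add: H_def inner_add_right)
    have an: "a \<noteq> 0" "v \<noteq> 0" using Gf(2) a v by auto
    have "f + (1 / (a \<bullet> a)) *\<^sub>R a \<in> H v" "f + (1 / (v \<bullet> v)) *\<^sub>R v \<in> H a"
      using pt an eq by blast+
    then have "v \<bullet> a = a \<bullet> a" "a \<bullet> v = v \<bullet> v"
      using an by (auto simp: H_def inner_add_right)
    then have "(a - v) \<bullet> (a - v) = 0"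
      by (simp add: inner_diff_left inner_diff_right inner_commute)
    then have "a = v" by simp
    then show "a \<in> A'" using v by simp
  qed
  show ?thesis using sub assms by blast
qed

end

theory Submission
  imports Defs
begin

text \<open>
  Let \<open>L v\<close> be the barycentric coordinates of the simplex with vertex set \<open>V\<close> and \<open>z k\<close> the integer
  point in the relative interior of the facet opposite to \<open>k\<close>. For \<open>f\<close> in the interior, the minimal
  lifting is unique iff \<open>r \<mapsto> inf_w \<psi> (r + w)\<close> and its reflection \<open>r \<mapsto> - f - r\<close> add up to
  \<open>1\<close>, and this means that the integer translates of the parallelepipeds
  \<open>\<Sum>_{l \<noteq> k} [0, L l (z k)] (l - f)\<close> cover the space; by
  lattice-freeness and the uniqueness of \<open>z k\<close> their interiors are disjoint.

  If the translates tile, let \<open>\<mu>\<close> be the smallest of the \<open>L l (z k)\<close>, attained at \<open>l = j0\<close>, and take \<open>f\<close>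
  generic. An alternating sum over sample points near \<open>\<mu> (j0 - f)\<close> shows that, for each \<open>k\<close>, the same number of
  tiles of type \<open>k\<close> have a corner there. Those corners correspond to the \<open>j \<noteq> k\<close> with \<open>L j (z k) = \<mu>\<close> and
  \<open>\<mu> (j0 - j)\<close> integer, and the uniqueness of \<open>z k\<close> leaves only the possibility that all
  \<open>L l (z k)\<close> are equal to \<open>1 / n\<close>. Lattice-freeness then makes the vectors \<open>(v - k) / n\<close> a lattice basis.
  Conversely, if these vectors are integer, a translate of \<open>r\<close> of minimal gauge and with fewest ties lies in a tile.
\<close>

section \<open>Integer points\<close>

lemma integer_points_0 [simp]: "0 \<in> integer_points"
  by (simp add: integer_points_def)

lemma integer_points_add [intro]:
  "x \<in> integer_points \<Longrightarrow> y \<in> integer_points \<Longrightarrow> x + y \<in> integer_points"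
  by (simp add: integer_points_def)

lemma integer_points_diff [intro]:
  "x \<in> integer_points \<Longrightarrow> y \<in> integer_points \<Longrightarrow> x - y \<in> integer_points"
  by (simp add: integer_points_def)

lemma integer_points_minus [intro]: "x \<in> integer_points \<Longrightarrow> - x \<in> integer_points"
  by (simp add: integer_points_def)

lemma integer_points_scaleR [intro]:
  "a \<in> \<int> \<Longrightarrow> x \<in> integer_points \<Longrightarrow> a *\<^sub>R x \<in> integer_points"
  by (simp add: integer_points_def)

lemma integer_points_sum [intro]:
  "(\<And>i. i \<in> I \<Longrightarrow> h i \<in> integer_points) \<Longrightarrow> sum h I \<in> integer_points"
  by (induction I rule: infinite_finite_induct) auto

lemma finite_integer_points_bounded:
  fixes p :: "real ^ 'n"
  shows "finite {w \<in> integer_points. norm (p + w) \<le> K}"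
proof (rule finite_subset)
  define S where "S = {k::int. \<bar>of_int k\<bar> \<le> norm p + K}"
  have "S \<subseteq> {- \<lceil>norm p + K\<rceil> .. \<lceil>norm p + K\<rceil>}"
    by (auto simp: S_def) linarith+
  then have "finite S" using finite_subset by blast
  then have "finite (PiE (UNIV::'n set) (\<lambda>_. S))" by (intro finite_PiE) auto
  then show "finite ((\<lambda>h. \<chi> i. real_of_int (h i)) ` (PiE (UNIV::'n set) (\<lambda>_. S)))" by blast
  show "{w \<in> integer_points. norm (p + w) \<le> K}
      \<subseteq> (\<lambda>h. \<chi> i. real_of_int (h i)) ` (PiE (UNIV::'n set) (\<lambda>_. S))"
  proof
    fix w assume w: "w \<in> {w \<in> integer_points. norm (p + w) \<le> K}"
    then have "\<forall>i. \<exists>k. w $ i = of_int k" by (auto simp: integer_points_def Ints_def)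
    then obtain h where h: "\<And>i. w $ i = of_int (h i)" by metis
    have "h i \<in> S" for i
    proof -
      have "\<bar>w $ i\<bar> \<le> norm w" by (rule component_le_norm_cart)
      also have "\<dots> \<le> norm p + K"
        using w norm_triangle_ineq4[of "p + w" p] by simp
      finally show ?thesis by (simp add: S_def h)
    qed
    moreover have "w = (\<chi> i. real_of_int (h i))" by (simp add: vec_eq_iff h)
    ultimately show "w \<in> (\<lambda>h. \<chi> i. real_of_int (h i)) ` (PiE (UNIV::'n set) (\<lambda>_. S))"
      by (auto simp: PiE_def)
  qed
qed

lemma countable_integer_points: "countable (integer_points :: (real ^ 'n) set)"
proof -
  have "(integer_points :: (real ^ 'n) set)
      = (\<Union>K::nat. {w \<in> integer_points. norm (0 + w) \<le> real K})"
    using real_arch_simple by auto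
  moreover have "countable (\<Union>K::nat. {w \<in> integer_points. norm (0 + (w :: real ^ 'n)) \<le> real K})"
    by (rule countable_UN) (simp, rule countable_finite, rule finite_integer_points_bounded)
  ultimately show ?thesis by simp
qed

text \<open>One unit of \<open>r\<close> and one of \<open>w - f - r\<close> together lead from
  \<open>f\<close> to \<open>w\<close>. The two directions may coincide, and then a single direction
  carries multiplicity 2.\<close>

lemma valid_integer_pair:
  assumes "valid_integer f \<pi>" "w \<in> integer_points"
  shows "1 \<le> \<pi> r + \<pi> (w - f - r)"
proof (cases "r = w - f - r")
  case True
  define s where "s x = (if x = r then 2 else 0 :: nat)" for x
  have s: "{x. s x \<noteq> 0} = {r}" by (auto simp: s_def)
  have fw: "f + 2 *\<^sub>R r = w" using True by (simp add: scaleR_2 eq_diff_eq algebra_simps)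
  have "1 \<le> (\<Sum>x | s x \<noteq> 0. \<pi> x * real (s x))"
  proof (rule assms(1)[unfolded valid_integer_def, THEN conjunct2, rule_format])
    show "f + (\<Sum>x | s x \<noteq> 0. real (s x) *\<^sub>R x) \<in> integer_points"
      unfolding s using fw assms(2) by (simp add: s_def)
  qed (unfold s, simp)
  then have "1 \<le> \<pi> r * 2" unfolding s by (simp add: s_def)
  moreover have "\<pi> (w - f - r) = \<pi> r" using True by metis
  ultimately show ?thesis by linarith
next
  case False
  define s where "s x = (if x = r \<or> x = w - f - r then 1 else 0 :: nat)" for x
  have s: "{x. s x \<noteq> 0} = {r, w - f - r}" by (auto simp: s_def)
  have "1 \<le> (\<Sum>x | s x \<noteq> 0. \<pi> x * real (s x))"
  proof (rule assms(1)[unfolded valid_integer_def, THEN conjunct2, rule_format])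
    show "f + (\<Sum>x | s x \<noteq> 0. real (s x) *\<^sub>R x) \<in> integer_points"
      unfolding s using False assms(2) by (simp add: s_def)
  qed (unfold s, simp)
  then show ?thesis using False unfolding s by (simp add: s_def)
qed

section \<open>Liftings of a gauge\<close>

text \<open>Zorn's lemma on the liftings below \<open>\<pi>\<close>. A chain is bounded by its
  pointwise infimum, which stays valid because each validity inequality involves only finitely many
  directions.\<close>

lemma exists_minimal_lifting_below:
  assumes \<pi>: "lifting f \<psi> \<pi>"
  shows "\<exists>\<pi>0. minimal_lifting f \<psi> \<pi>0 \<and> (\<forall>r. \<pi>0 r \<le> \<pi> r)"
proof -
  define A where "A = {\<pi>'. lifting f \<psi> \<pi>' \<and> \<pi>' \<le> \<pi>}"
  \<comment> \<open>\<open>P\<close> reverses the pointwise order, so that the maximal elements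
    delivered by \<open>predicate_Zorn\<close> are minimal functions.\<close>
  define P where "P a b \<longleftrightarrow> b \<le> (a :: real ^ 'a \<Rightarrow> real)" for a b
  have nonneg: "0 \<le> a r" if "a \<in> A" for a r
    using that by (auto simp: A_def lifting_def valid_integer_def)
  have "\<exists>m\<in>A. \<forall>a\<in>A. P m a \<longrightarrow> a = m"
  proof (rule predicate_Zorn)
    show "partial_order_on A (relation_of P A)"
      by (auto simp: P_def intro!: partial_order_on_relation_ofI)
    fix C assume C: "C \<in> Chains (relation_of P A)"
    show "\<exists>u\<in>A. \<forall>a\<in>C. P a u"
    proof (cases "C = {}")
      case True
      then show ?thesis using \<pi> by (auto simp: A_def)
    next
      case False
      have CA: "C \<subseteq> A" using C by (auto simp: Chains_def relation_of_def)
      have tot: "a \<le> b \<or> b \<le> a" if "a \<in> C" "b \<in> C" for a b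
        using C that by (auto simp: Chains_def relation_of_def P_def)
      define u where "u r = (INF a\<in>C. a r)" for r
      have bdd: "bdd_below ((\<lambda>a. a r) ` C)" for r
        using nonneg CA by (intro bdd_belowI[of _ 0]) auto
      have le: "u r \<le> a r" if "a \<in> C" for a r
        unfolding u_def using bdd that by (rule cINF_lower)
      have u0: "0 \<le> u r" for r
        unfolding u_def using False nonneg CA by (intro cINF_greatest) auto
      \<comment> \<open>A chain is totally ordered, so the smallest of finitely many near-optimal
        members is near-optimal at all points of \<open>S\<close> at once.\<close>
      have common: "\<exists>a\<in>C. \<forall>r\<in>S. a r \<le> u r + e" if "finite S" "e > 0" for S e
        using that
      proof (induction S)
        case empty
        then show ?case using False by auto
      next
        case (insert r S)
        then obtain a where a: "a \<in> C" "\<forall>r\<in>S. a r \<le> u r + e" by blast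
        have "\<exists>b\<in>C. b r < u r + e"
        proof -
          have "(INF a\<in>C. a r) < u r + e" using insert by (simp add: u_def)
          then show ?thesis using cINF_less_iff[OF False bdd] by blast
        qed
        then obtain b where b: "b \<in> C" "b r < u r + e" by blast
        show ?case
        proof (cases "a \<le> b")
          case True
          then have "a r \<le> b r" by (simp add: le_funD)
          then show ?thesis using a b by (intro bexI[of _ a]) auto
        next
          case False
          then have "b \<le> a" using tot a b by blast
          then have "\<And>r. b r \<le> a r" by (simp add: le_funD)
          then show ?thesis using a b by (intro bexI[of _ b]) (auto intro: order_trans)
        qed
      qed
      have "valid_integer f u"
        unfolding valid_integer_def
      proof (intro conjI allI impI)
        fix r show "0 \<le> u r" by (rule u0)
      next
        fix s :: "real ^ 'a \<Rightarrow> nat"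
        assume s: "finite {r. s r \<noteq> 0}"
          "f + (\<Sum>r | s r \<noteq> 0. real (s r) *\<^sub>R r) \<in> integer_points"
        let ?N = "\<Sum>r | s r \<noteq> 0. real (s r)"
        have "1 \<le> (\<Sum>r | s r \<noteq> 0. u r * real (s r)) + e" if "e > 0" for e
        proof -
          have N: "?N \<ge> 0" by (simp add: sum_nonneg)
          \<comment> \<open>Spreading the tolerance over \<open>?N\<close> units keeps the total
            error below \<open>e\<close>; the added 1 covers \<open>?N = 0\<close>.\<close>
          then obtain a where a: "a \<in> C" "\<forall>r\<in>{r. s r \<noteq> 0}. a r \<le> u r + e / (?N + 1)"
            using common[OF s(1), of "e / (?N + 1)"] \<open>e > 0\<close> by auto
          have "1 \<le> (\<Sum>r | s r \<noteq> 0. a r * real (s r))"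
            using a CA s by (auto simp: A_def lifting_def valid_integer_def)
          also have "\<dots> \<le> (\<Sum>r | s r \<noteq> 0. (u r + e / (?N + 1)) * real (s r))"
            using a by (intro sum_mono mult_right_mono) auto
          also have "\<dots> = (\<Sum>r | s r \<noteq> 0. u r * real (s r)) + e / (?N + 1) * ?N"
            by (simp add: distrib_right sum.distrib sum_distrib_left)
          also have "e / (?N + 1) * ?N \<le> e"
            using N \<open>e > 0\<close> by (simp add: field_simps)
          finally show ?thesis by simp
        qed
        then show "1 \<le> (\<Sum>r | s r \<noteq> 0. u r * real (s r))"
          by (rule field_le_epsilon)
      qed
      moreover obtain a where "a \<in> C" using False by blast
      then have "u \<le> a" "a \<in> A" using le CA by (auto simp: le_fun_def)
      then have "u \<le> \<pi>" "u \<le> \<psi>" "valid_continuous f \<psi>"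
        by (auto simp: A_def lifting_def le_fun_def intro: order_trans)
      ultimately have "u \<in> A" by (auto simp: A_def lifting_def le_fun_def)
      then show ?thesis using le by (auto simp: P_def le_fun_def)
    qed
  qed
  then obtain m where m: "m \<in> A" "\<And>a. a \<in> A \<Longrightarrow> a \<le> m \<Longrightarrow> a = m"
    by (auto simp: P_def)
  have "minimal_lifting f \<psi> m"
    unfolding minimal_lifting_def
  proof (intro conjI notI)
    show "lifting f \<psi> m" using m by (simp add: A_def)
    assume "\<exists>\<pi>'. lifting f \<psi> \<pi>' \<and> \<pi>' \<noteq> m \<and> (\<forall>r. \<pi>' r \<le> m r)"
    then obtain a where a: "lifting f \<psi> a" "a \<noteq> m" "a \<le> m" by (auto simp: le_fun_def)
    then have "a \<in> A" using m(1) by (auto simp: A_def)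
    then show False using a m by blast
  qed
  then show ?thesis using m(1) by (auto simp: A_def le_fun_def)
qed

text \<open>The properties of the gauge of a bounded lattice-free body around \<open>f\<close> on
  which the lifting theory rests. \<open>gauge_integer\<close> expresses lattice-freeness and
  \<open>gauge_norm\<close> boundedness; the sign of \<open>M\<close> is left open.\<close>

locale lattice_gauge =
  fixes f :: "real ^ 'n" and \<psi> :: "real ^ 'n \<Rightarrow> real" and M :: real
  assumes gauge_nonneg: "0 \<le> \<psi> r"
    and gauge_add: "\<psi> (x + y) \<le> \<psi> x + \<psi> y"
    and gauge_scale: "0 \<le> a \<Longrightarrow> \<psi> (a *\<^sub>R x) = a * \<psi> x"
    and gauge_integer: "w \<in> integer_points \<Longrightarrow> 1 \<le> \<psi> (w - f)"
    and gauge_norm: "norm r \<le> M * \<psi> r"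
begin

lemma gauge_0 [simp]: "\<psi> 0 = 0"
  using gauge_scale[of 0 0] by simp

lemma gauge_sum: "\<psi> (\<Sum>i\<in>I. h i) \<le> (\<Sum>i\<in>I. \<psi> (h i))"
proof (induction I rule: infinite_finite_induct)
  case (insert i I)
  then show ?case using gauge_add[of "h i" "sum h I"] by simp
qed auto

lemma gauge_pos: "r \<noteq> 0 \<Longrightarrow> 0 < \<psi> r"
  using gauge_norm[of r] gauge_nonneg[of r] by (cases "\<psi> r = 0") auto

lemma gauge_valid: "valid_continuous f \<psi>"
  unfolding valid_continuous_def
proof (intro conjI allI impI)
  fix r show "0 \<le> \<psi> r" by (rule gauge_nonneg)
next
  fix s :: "real ^ 'n \<Rightarrow> real"
  assume s: "\<forall>r. 0 \<le> s r" "finite {r. s r \<noteq> 0}"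
    "f + (\<Sum>r | s r \<noteq> 0. s r *\<^sub>R r) \<in> integer_points"
  have "1 \<le> \<psi> (\<Sum>r | s r \<noteq> 0. s r *\<^sub>R r)" using gauge_integer[OF s(3)] by simp
  also have "\<dots> \<le> (\<Sum>r | s r \<noteq> 0. \<psi> (s r *\<^sub>R r))" by (rule gauge_sum)
  also have "\<dots> = (\<Sum>r | s r \<noteq> 0. \<psi> r * s r)" using s gauge_scale by (simp add: mult.commute)
  finally show "1 \<le> (\<Sum>r | s r \<noteq> 0. \<psi> r * s r)" .
qed

lemma finite_translates: "finite {w \<in> integer_points. \<psi> (r + w) \<le> K}"
proof (rule finite_subset)
  show "{w \<in> integer_points. \<psi> (r + w) \<le> K}
      \<subseteq> {w \<in> integer_points. norm (r + w) \<le> \<bar>M\<bar> * K}"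
  proof clarify
    fix w assume "\<psi> (r + w) \<le> K"
    then have "M * \<psi> (r + w) \<le> \<bar>M\<bar> * K"
      using gauge_nonneg[of "r + w"] by (intro mult_mono) auto
    then show "norm (r + w) \<le> \<bar>M\<bar> * K" using gauge_norm[of "r + w"] by linarith
  qed
qed (rule finite_integer_points_bounded)

text \<open>This is the trivial fill-in of \<open>\<psi>\<close>, the lattice-periodic function
  obtained by minimising over integer translates.\<close>

definition trivial_lifting :: "real ^ 'n \<Rightarrow> real" where
  "trivial_lifting r = (INF w\<in>integer_points. \<psi> (r + w))"

lemma trivial_lifting_le:
  assumes "w \<in> integer_points"
  shows "trivial_lifting r \<le> \<psi> (r + w)"
  unfolding trivial_lifting_def
  using gauge_nonneg assms by (intro cINF_lower bdd_belowI[of _ 0]) auto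

text \<open>Only finitely many translates have gauge at most \<open>\<psi> r\<close>, and
  \<open>w = 0\<close> is one of them, so the infimum is a minimum.\<close>

lemma trivial_lifting_attained:
  obtains w where "w \<in> integer_points" "trivial_lifting r = \<psi> (r + w)"
proof -
  let ?S = "{w \<in> integer_points. \<psi> (r + w) \<le> \<psi> r}"
  have "0 \<in> ?S" by simp
  then have ne: "?S \<noteq> {}" by blast
  obtain w where w: "w \<in> ?S" "\<And>w'. w' \<in> ?S \<Longrightarrow> \<psi> (r + w) \<le> \<psi> (r + w')"
    using ex_min_if_finite[OF finite_imageI[OF finite_translates[of r "\<psi> r"]], of "\<lambda>w. \<psi> (r + w)"] ne
    by fastforce
  have "\<psi> (r + w) \<le> \<psi> (r + w')" if "w' \<in> integer_points" for w'
    using w(2)[of w'] w(1) that by fastforce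
  then have "\<psi> (r + w) \<le> trivial_lifting r"
    unfolding trivial_lifting_def using ne by (intro cINF_greatest) auto
  moreover have "trivial_lifting r \<le> \<psi> (r + w)" using w trivial_lifting_le by blast
  ultimately show thesis using that w by force
qed

lemma trivial_lifting_nonneg: "0 \<le> trivial_lifting r"
  using trivial_lifting_attained[of r] gauge_nonneg by metis

text \<open>Replacing each direction by its best translate moves the reached point by an integer
  vector only, so subadditivity and \<open>gauge_integer\<close> apply to the translated
  directions.\<close>

lemma trivial_lifting_is_lifting: "lifting f \<psi> trivial_lifting"
  unfolding lifting_def valid_integer_def
proof (intro conjI allI impI)
  show "valid_continuous f \<psi>" by (rule gauge_valid)
  fix r show "trivial_lifting r \<le> \<psi> r" using trivial_lifting_le[of 0 r] by simp
  show "0 \<le> trivial_lifting r" by (rule trivial_lifting_nonneg)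
next
  fix s :: "real ^ 'n \<Rightarrow> nat"
  let ?S = "{r. s r \<noteq> 0}"
  assume s: "finite ?S" "f + (\<Sum>r\<in>?S. real (s r) *\<^sub>R r) \<in> integer_points"
  obtain w where w: "\<And>r. w r \<in> integer_points" "\<And>r. trivial_lifting r = \<psi> (r + w r)"
    by (metis trivial_lifting_attained)
  let ?x = "\<Sum>r\<in>?S. real (s r) *\<^sub>R (r + w r)"
  have "f + ?x = (f + (\<Sum>r\<in>?S. real (s r) *\<^sub>R r)) + (\<Sum>r\<in>?S. real (s r) *\<^sub>R w r)"
    by (simp add: scaleR_add_right sum.distrib)
  also have "\<dots> \<in> integer_points"
    using s(2) w by (intro integer_points_add[OF s(2)] integer_points_sum integer_points_scaleR) auto
  finally have "1 \<le> \<psi> ?x" using gauge_integer[of "f + ?x"] by simp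
  also have "\<dots> \<le> (\<Sum>r\<in>?S. \<psi> (real (s r) *\<^sub>R (r + w r)))" by (rule gauge_sum)
  also have "\<dots> = (\<Sum>r\<in>?S. trivial_lifting r * real (s r))"
    by (simp add: gauge_scale w mult.commute)
  finally show "1 \<le> (\<Sum>r\<in>?S. trivial_lifting r * real (s r))" .
qed

text \<open>If \<open>trivial_lifting\<close> is self-complementary, it lies below every lifting.\<close>

lemma unique_minimal_lifting_if_covered:
  assumes cov: "\<And>r. trivial_lifting r + trivial_lifting (- f - r) \<le> 1"
  shows "\<exists>!\<pi>. minimal_lifting f \<psi> \<pi>"
proof
  have least: "trivial_lifting r \<le> \<pi> r" if \<pi>: "lifting f \<psi> \<pi>" for \<pi> r
  proof -
    obtain w where w: "w \<in> integer_points" "trivial_lifting (- f - r) = \<psi> (- f - r + w)"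
      by (metis trivial_lifting_attained)
    \<comment> \<open>Bounding the second summand by the gauge of the best translate leaves at least
      \<open>1 - trivial_lifting (- f - r)\<close> for \<open>\<pi> r\<close>.\<close>
    have "1 \<le> \<pi> r + \<pi> (w - f - r)"
      using \<pi> w by (intro valid_integer_pair) (auto simp: lifting_def)
    also have "\<pi> (w - f - r) \<le> \<psi> (- f - r + w)"
      using \<pi> by (simp add: lifting_def algebra_simps)
    finally show ?thesis using w cov[of r] by linarith
  qed
  then show "minimal_lifting f \<psi> trivial_lifting"
    unfolding minimal_lifting_def
    using trivial_lifting_is_lifting by (auto intro!: ext antisym)
  fix \<pi> assume "minimal_lifting f \<psi> \<pi>"
  then show "\<pi> = trivial_lifting"
    using least trivial_lifting_is_lifting unfolding minimal_lifting_def by metis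
qed

text \<open>Copies of \<open>r0\<close> are offered at price \<open>v\<close> each and everything
  else at its gauge; the cheapest way to assemble \<open>r\<close> defines the lifting. Condition
  \<open>adm\<close> says that no integer point becomes cheaper than 1; the case of no copies is
  \<open>gauge_integer\<close>.\<close>

lemma exists_lifting_with_value:
  assumes v: "0 \<le> v"
    and adm: "\<And>N w. 1 \<le> N \<Longrightarrow> w \<in> integer_points \<Longrightarrow> 1 \<le> real N * v + \<psi> (w - f - real N *\<^sub>R r0)"
  obtains \<pi> where "lifting f \<psi> \<pi>" "\<pi> r0 \<le> v"
proof -
  define h where "h r N = real N * v + \<psi> (r - real N *\<^sub>R r0)" for r N
  define \<pi> where "\<pi> r = (INF N. h r N)" for r
  have h0: "0 \<le> h r N" for r N using v gauge_nonneg by (simp add: h_def)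
  have bdd: "bdd_below (range (h r))" for r using h0 by (intro bdd_belowI[of _ 0]) auto
  have le: "\<pi> r \<le> h r N" for r N unfolding \<pi>_def using bdd by (rule cINF_lower) simp
  have \<pi>r0: "\<pi> r0 \<le> v" using le[of r0 1] by (simp add: h_def)
  have adm': "1 \<le> real N * v + \<psi> (w - f - real N *\<^sub>R r0)" if "w \<in> integer_points" for N w
    using adm[of N w] gauge_integer[of w] that by (cases N) auto
  have "lifting f \<psi> \<pi>"
    unfolding lifting_def valid_integer_def
  proof (intro conjI allI impI)
    show "valid_continuous f \<psi>" by (rule gauge_valid)
    fix r show "\<pi> r \<le> \<psi> r" using le[of r 0] by (simp add: h_def)
    show "0 \<le> \<pi> r" unfolding \<pi>_def using h0 by (intro cINF_greatest) auto
  next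
    fix s :: "real ^ 'n \<Rightarrow> nat"
    let ?S = "{r. s r \<noteq> 0}"
    assume s: "finite ?S" "f + (\<Sum>r\<in>?S. real (s r) *\<^sub>R r) \<in> integer_points"
    let ?K = "\<Sum>r\<in>?S. real (s r)"
    have "1 \<le> (\<Sum>r\<in>?S. \<pi> r * real (s r)) + e" if "e > 0" for e
    proof -
      have K: "?K \<ge> 0" by (simp add: sum_nonneg)
      have "\<exists>N. h r N < \<pi> r + e / (?K + 1)" for r
      proof -
        have "(INF N. h r N) < \<pi> r + e / (?K + 1)" using K \<open>e > 0\<close> by (simp add: \<pi>_def)
        then show ?thesis using cINF_less_iff[OF _ bdd] by blast
      qed
      \<comment> \<open>\<open>N r\<close> is a nearly optimal number of copies for
        \<open>r\<close>; collecting them over all directions gives \<open>?n\<close> copies of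
        \<open>r0\<close> in total.\<close>
      then obtain N where N: "\<And>r. h r (N r) < \<pi> r + e / (?K + 1)" by metis
      let ?n = "\<Sum>r\<in>?S. s r * N r"
      let ?w = "f + (\<Sum>r\<in>?S. real (s r) *\<^sub>R r)"
      have "1 \<le> real ?n * v + \<psi> (?w - f - real ?n *\<^sub>R r0)" using adm' s by blast
      also have "?w - f - real ?n *\<^sub>R r0 = (\<Sum>r\<in>?S. real (s r) *\<^sub>R (r - real (N r) *\<^sub>R r0))"
        by (simp add: scaleR_diff_right sum_subtractf scaleR_sum_left)
      also have "\<psi> \<dots> \<le> (\<Sum>r\<in>?S. \<psi> (real (s r) *\<^sub>R (r - real (N r) *\<^sub>R r0)))" by (rule gauge_sum)
      also have "real ?n * v + \<dots> = (\<Sum>r\<in>?S. h r (N r) * real (s r))"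
        unfolding h_def by (simp add: gauge_scale sum_distrib_left sum.distrib[symmetric]
            distrib_left mult.assoc mult.commute mult.left_commute del: neq0_conv)
      also have "\<dots> \<le> (\<Sum>r\<in>?S. (\<pi> r + e / (?K + 1)) * real (s r))"
        using N by (intro sum_mono mult_right_mono) (auto intro: less_imp_le)
      also have "\<dots> = (\<Sum>r\<in>?S. \<pi> r * real (s r)) + e / (?K + 1) * ?K"
        by (simp add: distrib_right sum.distrib sum_distrib_left)
      also have "e / (?K + 1) * ?K \<le> e" using K \<open>e > 0\<close> by (simp add: field_simps)
      finally show ?thesis by simp
    qed
    then show "1 \<le> (\<Sum>r\<in>?S. \<pi> r * real (s r))" by (rule field_le_epsilon)
  qed
  then show thesis using \<pi>r0 that by blast
qed

text \<open>Each lifting dominates a minimal one. Under uniqueness both dominate the same one, to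
  which the pair inequality applies.\<close>

lemma unique_minimal_lifting_values:
  assumes uniq: "\<exists>!\<pi>. minimal_lifting f \<psi> \<pi>"
    and "lifting f \<psi> \<pi>1" "lifting f \<psi> \<pi>2"
  shows "1 \<le> \<pi>1 r + \<pi>2 (- f - r)"
proof -
  obtain \<pi> where \<pi>: "minimal_lifting f \<psi> \<pi>" "\<pi> r \<le> \<pi>1 r" "\<pi> (- f - r) \<le> \<pi>2 (- f - r)"
    using uniq assms(2,3) exists_minimal_lifting_below by metis
  then have "1 \<le> \<pi> r + \<pi> (0 - f - r)"
    by (intro valid_integer_pair) (auto simp: minimal_lifting_def lifting_def)
  then show ?thesis using \<pi> by simp
qed

text \<open>If \<open>p + q > 1\<close>, there are liftings with value at most \<open>1 - q\<close>
  at \<open>r\<close> and strictly below \<open>q\<close> at \<open>- f - r\<close>, against the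
  previous lemma. The bound \<open>q \<le> 1 / 2\<close> makes two or more copies at price
  \<open>1 - q\<close> cost at least 1.\<close>

lemma covered_if_unique_aux:
  assumes uniq: "\<exists>!\<pi>. minimal_lifting f \<psi> \<pi>"
    and small: "trivial_lifting (- f - r) \<le> 1 / 2" and pos: "0 < trivial_lifting (- f - r)"
  shows "trivial_lifting r + trivial_lifting (- f - r) \<le> 1"
proof (rule ccontr)
  define g where "g = - f - r"
  define p where "p = trivial_lifting r"
  define q where "q = trivial_lifting g"
  assume "\<not> ?thesis"
  then have pq: "p + q > 1" by (simp add: p_def q_def g_def)
  have q: "0 < q" "q \<le> 1 / 2" using small pos by (auto simp: q_def g_def)
  have geq: "q \<le> \<psi> (w - f - r)" if "w \<in> integer_points" for w
    using trivial_lifting_le[OF that, of g] by (simp add: q_def g_def algebra_simps)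
  obtain wg where wg: "wg \<in> integer_points" "q = \<psi> (g + wg)"
    unfolding q_def by (metis trivial_lifting_attained)
  \<comment> \<open>Up to an integer vector, \<open>r\<close> is the remainder
    \<open>w - f - real N *\<^sub>R g\<close> plus \<open>N - 1\<close> copies of \<open>g\<close>,
    and each copy costs \<open>q\<close> after translation.\<close>
  have key: "p + q \<le> real N * q + \<psi> (w - f - real N *\<^sub>R g)"
    if N: "1 \<le> N" and w: "w \<in> integer_points" for N w
  proof -
    let ?g = "g + wg" and ?z = "w + real N *\<^sub>R wg"
    have "r + (?z - wg) = (?z - f - real N *\<^sub>R ?g) + (real N - 1) *\<^sub>R ?g"
      by (simp add: g_def algebra_simps)
    then have "\<psi> (r + (?z - wg)) \<le> \<psi> (?z - f - real N *\<^sub>R ?g) + \<psi> ((real N - 1) *\<^sub>R ?g)"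
      using gauge_add by metis
    also have "\<psi> ((real N - 1) *\<^sub>R ?g) = (real N - 1) * q"
      using gauge_scale[of "real N - 1" ?g] N wg(2) by simp
    finally have "\<psi> (r + (?z - wg)) \<le> \<psi> (?z - f - real N *\<^sub>R ?g) + (real N - 1) * q" .
    moreover have "p \<le> \<psi> (r + (?z - wg))"
      unfolding p_def using w wg by (intro trivial_lifting_le integer_points_diff integer_points_add) auto
    moreover have "?z - f - real N *\<^sub>R ?g = w - f - real N *\<^sub>R g" by (simp add: algebra_simps)
    ultimately show ?thesis by (simp add: algebra_simps)
  qed
  \<comment> \<open>If \<open>real N * q \<le> 2\<close>, the second bound keeps the loss
    \<open>real N * \<eta>\<close> within the surplus \<open>p + q - 1\<close> of
    \<open>key\<close>; otherwise half of each \<open>q\<close> already pays 1.\<close>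
  define \<eta> where "\<eta> = min (q / 2) ((p + q - 1) * q / 2)"
  have \<eta>: "0 < \<eta>" "\<eta> \<le> q / 2" "\<eta> \<le> (p + q - 1) * q / 2" using q pq by (auto simp: \<eta>_def)
  obtain \<pi>1 where \<pi>1: "lifting f \<psi> \<pi>1" "\<pi>1 r \<le> 1 - q"
  proof (rule exists_lifting_with_value[of "1 - q" r])
    show "0 \<le> 1 - q" using q by simp
    fix N :: nat and w :: "real ^ 'n" assume N: "1 \<le> N" and w: "w \<in> integer_points"
    show "1 \<le> real N * (1 - q) + \<psi> (w - f - real N *\<^sub>R r)"
    proof (cases "N = 1")
      case True
      then show ?thesis using geq[OF w] by simp
    next
      case False
      then have "2 * (1 / 2) \<le> real N * (1 - q)" using N q by (intro mult_mono) auto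
      then show ?thesis using gauge_nonneg[of "w - f - real N *\<^sub>R r"] by simp
    qed
  qed
  obtain \<pi>2 where \<pi>2: "lifting f \<psi> \<pi>2" "\<pi>2 g \<le> q - \<eta>"
  proof (rule exists_lifting_with_value[of "q - \<eta>" g])
    show "0 \<le> q - \<eta>" using \<eta> q by linarith
    fix N :: nat and w :: "real ^ 'n" assume N: "1 \<le> N" and w: "w \<in> integer_points"
    show "1 \<le> real N * (q - \<eta>) + \<psi> (w - f - real N *\<^sub>R g)"
    proof (cases "real N * q \<le> 2")
      case True
      have "real N * \<eta> \<le> real N * ((p + q - 1) * q / 2)" using \<eta> by (intro mult_left_mono) auto
      also have "\<dots> = (p + q - 1) * (real N * q) / 2" by simp
      also have "\<dots> \<le> (p + q - 1) * 2 / 2" using True pq by (intro divide_right_mono mult_left_mono) auto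
      finally show ?thesis using key[OF N w] by (simp add: algebra_simps)
    next
      case False
      have "real N * \<eta> \<le> real N * (q / 2)" using \<eta> by (intro mult_left_mono) auto
      then show ?thesis using False gauge_nonneg[of "w - f - real N *\<^sub>R g"] by (simp add: algebra_simps)
    qed
  qed
  show False
    using unique_minimal_lifting_values[OF uniq \<pi>1(1) \<pi>2(1), of r] \<pi>1(2) \<pi>2(2) \<eta>(1) by (simp add: g_def)
qed

lemma trivial_lifting_pos:
  assumes "r \<notin> integer_points"
  shows "0 < trivial_lifting r"
proof -
  obtain w where w: "w \<in> integer_points" "trivial_lifting r = \<psi> (r + w)"
    by (metis trivial_lifting_attained)
  have "r + w \<noteq> 0" using assms w integer_points_minus by (metis add_eq_0_iff add.commute)
  then show ?thesis using gauge_pos w by simp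
qed

text \<open>The first two genericity conditions make both values positive, so the preceding lemma
  settles the case that one is at most 1/2. If both exceed 1/2, the third condition allows prices
  below 1/2 at both \<open>r\<close> and \<open>- f - r\<close>.\<close>

lemma covered_if_unique:
  assumes uniq: "\<exists>!\<pi>. minimal_lifting f \<psi> \<pi>"
    and gen: "r \<notin> integer_points" "- f - r \<notin> integer_points" "- f - 2 *\<^sub>R r \<notin> integer_points"
  shows "trivial_lifting r + trivial_lifting (- f - r) \<le> 1"
proof -
  define g where "g = - f - r"
  define p where "p = trivial_lifting r"
  define q where "q = trivial_lifting g"
  have pos: "0 < p" "0 < q" using gen trivial_lifting_pos by (auto simp: p_def q_def g_def)
  consider "q \<le> 1 / 2" | "p \<le> 1 / 2" | "p > 1 / 2" "q > 1 / 2" by linarith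
  then show ?thesis
  proof cases
    case 1
    then show ?thesis using covered_if_unique_aux[OF uniq] pos by (simp add: q_def g_def)
  next
    case 2
    have "- f - g = r" by (simp add: g_def)
    then show ?thesis using covered_if_unique_aux[OF uniq, of g] pos 2
      by (simp add: p_def g_def add.commute)
  next
    case 3
    have gen': "- f - 2 *\<^sub>R g \<notin> integer_points"
      using gen(3) integer_points_minus[of "- f - 2 *\<^sub>R g"] by (auto simp: g_def algebra_simps scaleR_2)
    define \<eta> where "\<eta> = min (1 / 6) (min (trivial_lifting (- f - 2 *\<^sub>R r)) (trivial_lifting (- f - 2 *\<^sub>R g)) / 2)"
    have \<eta>: "0 < \<eta>" "\<eta> \<le> 1 / 6" "2 * \<eta> \<le> trivial_lifting (- f - 2 *\<^sub>R r)"
        "2 * \<eta> \<le> trivial_lifting (- f - 2 *\<^sub>R g)"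
      using trivial_lifting_pos[OF gen(3)] trivial_lifting_pos[OF gen'] by (auto simp: \<eta>_def)
    \<comment> \<open>One copy is paid for by the complementary value, two copies by the slack
      \<open>2 * \<eta>\<close> of the remaining gauge, and three or more by the price being at
      least 1/3.\<close>
    have val: "\<exists>\<pi>. lifting f \<psi> \<pi> \<and> \<pi> y \<le> max (1 - trivial_lifting (- f - y)) (1 / 2 - \<eta>)"
      if "2 * \<eta> \<le> trivial_lifting (- f - 2 *\<^sub>R y)" for y
    proof -
      let ?v = "max (1 - trivial_lifting (- f - y)) (1 / 2 - \<eta>)"
      show ?thesis
      proof (rule exists_lifting_with_value[of ?v y])
        show "0 \<le> ?v" using \<eta> by simp
        fix N :: nat and w :: "real ^ 'n" assume N: "1 \<le> N" and w: "w \<in> integer_points"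
        consider "N = 1" | "N = 2" | "3 \<le> N" using N by linarith
        then show "1 \<le> real N * ?v + \<psi> (w - f - real N *\<^sub>R y)"
        proof cases
          case 1
          then show ?thesis using trivial_lifting_le[OF w, of "- f - y"] by (simp add: algebra_simps)
        next
          case 2
          have a: "2 * \<eta> \<le> \<psi> (w - f - real N *\<^sub>R y)"
            using trivial_lifting_le[OF w, of "- f - 2 *\<^sub>R y"] that 2 by (simp add: algebra_simps)
          have "2 * (1 / 2 - \<eta>) \<le> real N * ?v" using 2 \<eta> by (intro mult_mono) auto
          from add_mono[OF this a] show ?thesis by simp
        next
          case 3
          have "1 / 3 \<le> ?v" using \<eta> by (intro max.coboundedI2) linarith
          then have "3 * (1 / 3) \<le> real N * ?v" using 3 by (intro mult_mono) auto
          then show ?thesis using gauge_nonneg[of "w - f - real N *\<^sub>R y"] by simp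
        qed
      qed auto
    qed
    obtain \<pi>1 \<pi>2 where \<pi>: "lifting f \<psi> \<pi>1" "\<pi>1 r \<le> max (1 - q) (1 / 2 - \<eta>)"
        "lifting f \<psi> \<pi>2" "\<pi>2 g \<le> max (1 - p) (1 / 2 - \<eta>)"
      using val[OF \<eta>(3)] val[OF \<eta>(4)] by (auto simp: p_def q_def g_def)
    then show ?thesis
      using unique_minimal_lifting_values[OF uniq \<pi>(1,3), of r] 3 \<eta>(1)
      by (simp add: p_def q_def g_def max_def split: if_splits)
  qed
qed

end

section \<open>Barycentric coordinates and the gauge of a simplex\<close>

text \<open>The barycentric coordinate at \<open>v\<close> is split into its gradient
  \<open>g v\<close> and constant \<open>c v\<close>, since directions see only the
  gradient.\<close>

locale affine_frame =
  fixes V :: "(real ^ 'n) set" and g :: "real ^ 'n \<Rightarrow> real ^ 'n" and c :: "real ^ 'n \<Rightarrow> real"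
  assumes finite_V: "finite V"
    and card_V: "card V = CARD('n) + 1"
    and coords_sum: "(\<Sum>v\<in>V. g v \<bullet> x + c v) = 1"
    and coords_repr: "(\<Sum>v\<in>V. (g v \<bullet> x + c v) *\<^sub>R v) = x"
    and coords_vertex: "u \<in> V \<Longrightarrow> v \<in> V \<Longrightarrow> g v \<bullet> u + c v = (if u = v then 1 else 0)"
begin

definition L :: "real ^ 'n \<Rightarrow> real ^ 'n \<Rightarrow> real" where
  "L v x = g v \<bullet> x + c v"

lemma L_add: "L v (x + r) = L v x + g v \<bullet> r"
  by (simp add: L_def inner_add_right)

lemma L_diff: "L v (x - r) = L v x - g v \<bullet> r"
  by (simp add: L_def inner_diff_right)

lemma g_diff: "g v \<bullet> (x - y) = L v x - L v y"
  by (simp add: L_def inner_diff_right)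

lemma sum_L: "(\<Sum>v\<in>V. L v x) = 1"
  using coords_sum by (simp add: L_def)

lemma repr_L: "(\<Sum>v\<in>V. L v x *\<^sub>R v) = x"
  using coords_repr by (simp add: L_def)

lemma L_vertex: "u \<in> V \<Longrightarrow> v \<in> V \<Longrightarrow> L v u = (if u = v then 1 else 0)"
  using coords_vertex by (simp add: L_def)

lemma sum_g: "(\<Sum>v\<in>V. g v \<bullet> r) = 0"
  using sum_L[of "0 + r", unfolded L_add sum.distrib] sum_L[of 0] by simp

lemma repr_g: "(\<Sum>v\<in>V. (g v \<bullet> r) *\<^sub>R v) = r"
  using repr_L[of "0 + r", unfolded L_add scaleR_add_left sum.distrib] repr_L[of 0] by simp

lemma V_nonempty: "V \<noteq> {}"
  using card_V by auto

lemma g_eq_0_imp: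
  assumes "\<And>v. v \<in> V \<Longrightarrow> g v \<bullet> r = 0"
  shows "r = 0"
proof -
  have "(\<Sum>v\<in>V. (g v \<bullet> r) *\<^sub>R v) = 0" using assms by simp
  then show ?thesis by (simp add: repr_g)
qed

lemma L_ext: "(\<And>v. v \<in> V \<Longrightarrow> L v x = L v y) \<Longrightarrow> x = y"
  using g_eq_0_imp[of "x - y"] by (simp add: g_diff)

end

locale gauge_frame = affine_frame V g c
  for V :: "(real ^ 'n) set" and g :: "real ^ 'n \<Rightarrow> real ^ 'n" and c :: "real ^ 'n \<Rightarrow> real" +
  fixes f :: "real ^ 'n"
  assumes f_pos: "v \<in> V \<Longrightarrow> 0 < g v \<bullet> f + c v"
    and lattice_free: "w \<in> integer_points \<Longrightarrow> \<exists>v\<in>V. g v \<bullet> w + c v \<le> 0"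
begin

lemma Lf_pos: "v \<in> V \<Longrightarrow> 0 < L v f"
  using f_pos by (simp add: L_def)

lemma Lf_le_1: "v \<in> V \<Longrightarrow> L v f \<le> 1"
  using sum_L[of f] member_le_sum[of v V "\<lambda>v. L v f"] Lf_pos finite_V by (force intro: less_imp_le)

lemma free_L: "w \<in> integer_points \<Longrightarrow> \<exists>v\<in>V. L v w \<le> 0"
  using lattice_free by (simp add: L_def)

text \<open>\<open>slope v\<close> is the functional of the facet opposite to \<open>v\<close>,
  normalised to take the value 1 at \<open>x - f\<close> for \<open>x\<close> on that facet.\<close>

definition slope :: "real ^ 'n \<Rightarrow> real ^ 'n \<Rightarrow> real" where
  "slope v r = - (g v \<bullet> r) / L v f"

lemma slope_add: "slope v (x + y) = slope v x + slope v y"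
  by (simp add: slope_def inner_add_right add_divide_distrib diff_divide_distrib)

lemma slope_diff: "slope v (x - y) = slope v x - slope v y"
  by (simp add: slope_def inner_diff_right diff_divide_distrib)

lemma slope_scale: "slope v (a *\<^sub>R x) = a * slope v x"
  by (simp add: slope_def)

lemma slope_to_f: "v \<in> V \<Longrightarrow> slope v (x - f) = 1 - L v x / L v f"
  using Lf_pos[of v] by (simp add: slope_def g_diff field_simps)

lemma g_slope: "v \<in> V \<Longrightarrow> g v \<bullet> r = - (L v f * slope v r)"
  using Lf_pos[of v] by (simp add: slope_def)

text \<open>This positive linear relation between the facet functionals is what makes their maximum
  nonnegative.\<close>

lemma sum_slope: "(\<Sum>v\<in>V. L v f * slope v r) = 0"
proof -
  have "(\<Sum>v\<in>V. L v f * slope v r) = (\<Sum>v\<in>V. - (g v \<bullet> r))" using g_slope by (intro sum.cong) auto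
  then show ?thesis by (simp add: sum_negf sum_g)
qed

definition \<psi> :: "real ^ 'n \<Rightarrow> real" where
  "\<psi> r = Max ((\<lambda>v. slope v r) ` V)"

lemma slope_le: "v \<in> V \<Longrightarrow> slope v r \<le> \<psi> r"
  unfolding \<psi>_def using finite_V by (intro Max_ge) auto

lemma \<psi>_attained: "\<exists>v\<in>V. \<psi> r = slope v r"
proof -
  have "\<psi> r \<in> (\<lambda>v. slope v r) ` V" unfolding \<psi>_def using finite_V V_nonempty by (intro Max_in) auto
  then show ?thesis by blast
qed

lemma \<psi>_le: "(\<And>v. v \<in> V \<Longrightarrow> slope v r \<le> K) \<Longrightarrow> \<psi> r \<le> K"
  using \<psi>_attained by metis

lemma \<psi>_eq: "k \<in> V \<Longrightarrow> (\<And>v. v \<in> V \<Longrightarrow> slope v r \<le> slope k r) \<Longrightarrow> \<psi> r = slope k r"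
  using \<psi>_le slope_le by (meson antisym)

sublocale lattice_gauge f \<psi> "\<Sum>v\<in>V. norm v"
proof
  show nonneg: "0 \<le> \<psi> r" for r
  proof (rule ccontr)
    assume "\<not> 0 \<le> \<psi> r"
    then have "\<And>v. v \<in> V \<Longrightarrow> L v f * slope v r < 0"
      using slope_le[of _ r] Lf_pos by (intro mult_pos_neg) (auto simp: not_le intro: order_le_less_trans)
    then have "(\<Sum>v\<in>V. L v f * slope v r) < (\<Sum>v\<in>V. 0)"
      using finite_V V_nonempty by (intro sum_strict_mono) auto
    then show False by (simp add: sum_slope)
  qed
  show "\<psi> (x + y) \<le> \<psi> x + \<psi> y" for x y
    by (intro \<psi>_le) (auto simp: slope_add intro: add_mono slope_le)
  show "\<psi> (a *\<^sub>R x) = a * \<psi> x" if "0 \<le> a" for a x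
  proof -
    obtain k where "k \<in> V" "\<psi> x = slope k x" using \<psi>_attained by blast
    then show ?thesis
      using \<psi>_eq[of k "a *\<^sub>R x"] that by (metis mult_left_mono slope_le slope_scale)
  qed
  show "1 \<le> \<psi> (w - f)" if w: "w \<in> integer_points" for w
  proof -
    obtain v where v: "v \<in> V" "L v w \<le> 0" using free_L w by blast
    then have "L v w / L v f \<le> 0" using Lf_pos[of v] by (simp add: divide_le_0_iff)
    then show ?thesis using slope_le[OF v(1), of "w - f"] slope_to_f[OF v(1)] by simp
  qed
  show "norm r \<le> (\<Sum>v\<in>V. norm v) * \<psi> r" for r
  proof -
    \<comment> \<open>Each slope bounds its \<open>g v\<close> from below; since all
      \<open>g u\<close> sum to zero, the lower bounds for the others give the upper bound.\<close>
    have bound: "\<bar>g v \<bullet> r\<bar> \<le> \<psi> r" if v: "v \<in> V" for v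
    proof -
      have "g u \<bullet> r \<ge> - (L u f * \<psi> r)" if "u \<in> V" for u
        using slope_le[OF that, of r] Lf_pos[OF that] by (simp add: g_slope that)
      then have ge: "- (g u \<bullet> r) \<le> L u f * \<psi> r" if "u \<in> V" for u using that by force
      have s1: "L v f + (\<Sum>u\<in>V-{v}. L u f) = 1"
        using sum.remove[OF finite_V v, of "\<lambda>u. L u f"] sum_L[of f] by simp
      have "g v \<bullet> r = (\<Sum>u\<in>V-{v}. - (g u \<bullet> r))"
        using sum.remove[OF finite_V v, of "\<lambda>u. g u \<bullet> r"] sum_g[of r] by (simp add: sum_negf)
      also have "\<dots> \<le> (\<Sum>u\<in>V-{v}. L u f * \<psi> r)" using ge by (intro sum_mono) auto
      also have "\<dots> = (1 - L v f) * \<psi> r" using s1 by (simp add: sum_distrib_right[symmetric])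
      also have "\<dots> \<le> 1 * \<psi> r" using Lf_pos[OF v] nonneg by (intro mult_right_mono) auto
      finally have "g v \<bullet> r \<le> \<psi> r" by simp
      moreover have "L v f * \<psi> r \<le> 1 * \<psi> r" using Lf_le_1[OF v] nonneg by (intro mult_right_mono) auto
      ultimately show ?thesis using ge[OF v] by simp
    qed
    have "norm r = norm (\<Sum>v\<in>V. (g v \<bullet> r) *\<^sub>R v)" by (simp add: repr_g)
    also have "\<dots> \<le> (\<Sum>v\<in>V. \<bar>g v \<bullet> r\<bar> * norm v)"
      using norm_sum[of "\<lambda>v. (g v \<bullet> r) *\<^sub>R v" V] by simp
    also have "\<dots> \<le> (\<Sum>v\<in>V. \<psi> r * norm v)"
      using bound by (intro sum_mono mult_right_mono) auto
    also have "\<dots> = (\<Sum>v\<in>V. norm v) * \<psi> r"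
      by (subst mult.commute) (rule sum_distrib_right[symmetric])
    finally show ?thesis .
  qed
qed

text \<open>A translate \<open>r + w\<close> that minimises the gauge and, among those, the number of facets attaining
  it, lies in a tile: otherwise shifting it by \<open>(k - m) / n\<close> lowers the gauge or removes a tie.\<close>

lemma covered_if_divisible:
  assumes V_int: "V \<subseteq> integer_points"
    and div: "\<And>u v. u \<in> V \<Longrightarrow> v \<in> V \<Longrightarrow> (1 / real CARD('n)) *\<^sub>R (u - v) \<in> integer_points"
  shows "trivial_lifting r + trivial_lifting (- f - r) \<le> 1"
proof -
  let ?n = "real CARD('n)"
  have n: "?n > 0" by simp
  define S where "S = {w \<in> integer_points. \<psi> (r + w) \<le> trivial_lifting r}"
  have finS: "finite S" unfolding S_def by (rule finite_translates)
  have S_eq: "\<psi> (r + w) = trivial_lifting r" if "w \<in> S" for w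
    using that trivial_lifting_le[of w r] by (auto simp: S_def)
  obtain w0 where "w0 \<in> integer_points" "trivial_lifting r = \<psi> (r + w0)"
    by (rule trivial_lifting_attained)
  then have "w0 \<in> S" by (simp add: S_def)
  then have "S \<noteq> {}" by blast
  define ties where "ties w = {v \<in> V. slope v (r + w) = \<psi> (r + w)}" for w
  obtain w where w: "w \<in> S" "\<And>w'. w' \<in> S \<Longrightarrow> card (ties w) \<le> card (ties w')"
    using arg_min_if_finite[OF finS \<open>S \<noteq> {}\<close>, of "\<lambda>w. card (ties w)"] by (meson not_le)
  define r' where "r' = r + w"
  have wint: "w \<in> integer_points" using w(1) by (simp add: S_def)
  have min: "\<psi> r' = trivial_lifting r" using S_eq[OF w(1)] by (simp add: r'_def)
  obtain k where k: "k \<in> V" "\<psi> r' = slope k r'" using \<psi>_attained by blast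
  have bound: "L m f * (\<psi> r' - slope m r') \<le> 1 / ?n" if m: "m \<in> V" for m
  proof (rule ccontr)
    assume gt: "\<not> ?thesis"
    have mk: "m \<noteq> k" using gt k n by auto
    \<comment> \<open>This shift lowers the slope at \<open>k\<close> and raises the one at
      \<open>m\<close>, where \<open>gt\<close> leaves enough room; all other slopes stay the
      same.\<close>
    define d where "d = (1 / ?n) *\<^sub>R (k - m)"
    have dint: "d \<in> integer_points" unfolding d_def using div k m by blast
    have gd: "g v \<bullet> d = ((if v = k then 1 else 0) - (if v = m then 1 else 0)) / ?n" if "v \<in> V" for v
      using g_diff[of v k m] L_vertex k m that by (auto simp: d_def)
    have sd: "slope v (r' + d) = slope v r' - ((if v = k then 1 else 0) - (if v = m then 1 else 0)) / (?n * L v f)"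
      if "v \<in> V" for v
      unfolding slope_add by (simp add: slope_def[of _ d] gd[OF that])
    have sm: "slope m (r' + d) < \<psi> r'"
    proof -
      have "1 / ?n < (\<psi> r' - slope m r') * L m f" using gt by (simp add: mult.commute)
      then have "1 / ?n / L m f < \<psi> r' - slope m r'"
        by (simp only: pos_divide_less_eq[OF Lf_pos[OF m]])
      then show ?thesis using sd[OF m] mk by (simp add: divide_divide_eq_left)
    qed
    have sk: "slope k (r' + d) < \<psi> r'"
      using sd[OF k(1)] mk k Lf_pos[OF k(1)] n by simp
    have so: "slope v (r' + d) = slope v r'" if "v \<in> V" "v \<noteq> k" "v \<noteq> m" for v
      using sd that by simp
    have "slope v (r' + d) \<le> \<psi> r'" if "v \<in> V" for v
      using sm sk so slope_le that by (metis less_imp_le)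
    then have "\<psi> (r' + d) \<le> \<psi> r'" by (rule \<psi>_le)
    then have wd: "w + d \<in> S" using dint wint min by (auto simp: S_def r'_def add.assoc)
    then have eq: "\<psi> (r' + d) = \<psi> r'" using S_eq min by (simp add: r'_def add.assoc)
    have ties: "ties (w + d) = {v \<in> V. slope v (r' + d) = \<psi> r'}" "ties w = {v \<in> V. slope v r' = \<psi> r'}"
      using eq by (auto simp: ties_def r'_def add.assoc)
    have "v \<in> ties w" if v: "v \<in> ties (w + d)" for v
    proof -
      have "v \<noteq> m" "v \<noteq> k" using v sm sk by (auto simp: ties)
      then show ?thesis using v so[of v] by (simp add: ties)
    qed
    moreover have "k \<in> ties w" "k \<notin> ties (w + d)" using k sk by (auto simp: ties)
    ultimately have "ties (w + d) \<subset> ties w" by blast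
    then have "card (ties (w + d)) < card (ties w)"
      using finite_V by (intro psubset_card_mono) (auto simp: ties_def)
    then show False using w(2)[OF wd] by simp
  qed
  \<comment> \<open>The barycentre of the facet opposite to \<open>k\<close> serves as the integer
    target for the complement; \<open>z_eq\<close> exhibits its integrality.\<close>
  define z where "z = (\<Sum>u\<in>V-{k}. (1 / ?n) *\<^sub>R u)"
  have cardVk: "card (V - {k}) = CARD('n)" using card_V k finite_V by simp
  have z_eq: "z = k + (\<Sum>u\<in>V-{k}. (1 / ?n) *\<^sub>R (u - k))"
    using cardVk by (simp add: z_def scaleR_diff_right sum_subtractf sum_constant_scaleR del: sum_constant)
  have zint: "z \<in> integer_points"
    unfolding z_eq using V_int k div by (intro integer_points_add integer_points_sum) auto
  have Lz: "L v z = (if v = k then 0 else 1 / ?n)" if v: "v \<in> V" for v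
  proof -
    have "L v z = L v k + (\<Sum>u\<in>V-{k}. (L v u - L v k) / ?n)"
      unfolding z_eq by (simp add: L_add inner_sum_right g_diff)
    also have "(\<Sum>u\<in>V-{k}. (L v u - L v k) / ?n) = (\<Sum>u\<in>V-{k}. (if u = v then 1 / ?n else 0) - (if k = v then 1 / ?n else 0))"
      using v k L_vertex by (intro sum.cong) auto
    also have "\<dots> = (if v = k then - 1 else 1 / ?n)"
      using v cardVk finite_V by (auto simp: sum_subtractf)
    finally show ?thesis using v k L_vertex by auto
  qed
  have "\<psi> (z - f - r') \<le> 1 - \<psi> r'"
  proof (rule \<psi>_le)
    fix v assume v: "v \<in> V"
    \<comment> \<open>Divided by \<open>L v f\<close>, this is exactly the slope inequality wanted
      for \<open>z - f - r'\<close>; for \<open>v = k\<close> both sides vanish.\<close>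
    have "L v f * (\<psi> r' - slope v r') \<le> L v z"
      using bound[OF v] k by (auto simp: Lz v)
    then show "slope v (z - f - r') \<le> 1 - \<psi> r'"
      unfolding slope_diff[of v "z - f"] slope_to_f[OF v]
      using Lf_pos[OF v] by (simp add: field_simps)
  qed
  moreover have "trivial_lifting (- f - r) \<le> \<psi> (- f - r + (z - w))"
    using zint wint by (intro trivial_lifting_le) auto
  moreover have "- f - r + (z - w) = z - f - r'" by (simp add: r'_def)
  ultimately show ?thesis using min by simp
qed

end

section \<open>Tiling by parallelepipeds\<close>

text \<open>Countably many points and hyperplanes form a negligible set, while a nonempty open set
  is not negligible.\<close>

lemma exists_generic_point:
  fixes U :: "'a :: euclidean_space set"
  assumes U: "open U" "U \<noteq> {}" and "countable I" "countable Y"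
    and a: "\<And>i. i \<in> I \<Longrightarrow> a i \<noteq> 0"
  shows "\<exists>x\<in>U. x \<notin> Y \<and> (\<forall>i\<in>I. a i \<bullet> x \<noteq> b i)"
proof (rule ccontr)
  assume "\<not> ?thesis"
  then have "U \<subseteq> Y \<union> \<Union>((\<lambda>i. {x. a i \<bullet> x = b i}) ` I)" by blast
  moreover have "negligible (\<Union>((\<lambda>i. {x. a i \<bullet> x = b i}) ` I))"
    using assms by (intro negligible_countable_Union) (auto intro: negligible_hyperplane)
  moreover have "negligible Y"
  proof -
    have "negligible (\<Union>((\<lambda>y. {y}) ` Y))"
      using assms by (intro negligible_countable_Union) auto
    then show ?thesis by simp
  qed
  ultimately have "negligible U" using negligible_subset negligible_Un by blast
  then show False using U open_not_negligible by blast
qed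

locale lattice_simplex = affine_frame V g c
  for V :: "(real ^ 'n) set" and g :: "real ^ 'n \<Rightarrow> real ^ 'n" and c :: "real ^ 'n \<Rightarrow> real" +
  fixes z :: "real ^ 'n \<Rightarrow> real ^ 'n"
  assumes no_interior_integer: "w \<in> integer_points \<Longrightarrow> \<exists>v\<in>V. g v \<bullet> w + c v \<le> 0"
    and z_integer: "v \<in> V \<Longrightarrow> z v \<in> integer_points"
    and z_on_facet: "v \<in> V \<Longrightarrow> g v \<bullet> z v + c v = 0"
    and z_inside: "u \<in> V \<Longrightarrow> v \<in> V \<Longrightarrow> u \<noteq> v \<Longrightarrow> 0 < g u \<bullet> z v + c u"
    and z_unique: "v \<in> V \<Longrightarrow> w \<in> integer_points \<Longrightarrow> g v \<bullet> w + c v = 0 \<Longrightarrow>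
        (\<And>u. u \<in> V \<Longrightarrow> u \<noteq> v \<Longrightarrow> 0 < g u \<bullet> w + c u) \<Longrightarrow> w = z v"
begin

lemma Lz_0: "v \<in> V \<Longrightarrow> L v (z v) = 0"
  using z_on_facet by (simp add: L_def)

lemma Lz_pos: "u \<in> V \<Longrightarrow> v \<in> V \<Longrightarrow> u \<noteq> v \<Longrightarrow> 0 < L u (z v)"
  using z_inside by (simp add: L_def)

lemma eq_z: "v \<in> V \<Longrightarrow> w \<in> integer_points \<Longrightarrow> L v w = 0 \<Longrightarrow>
    (\<And>u. u \<in> V \<Longrightarrow> u \<noteq> v \<Longrightarrow> 0 < L u w) \<Longrightarrow> w = z v"
  using z_unique by (simp add: L_def)

end

text \<open>The tiling is not an assumption here: covering is derived from uniqueness of the minimal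
  lifting in \<open>tiles_cover\<close>, and disjointness of interiors from lattice-freeness and
  \<open>z_unique\<close>.\<close>

locale tiled_simplex = lattice_simplex V g c z
  for V :: "(real ^ 'n) set" and g :: "real ^ 'n \<Rightarrow> real ^ 'n" and c :: "real ^ 'n \<Rightarrow> real"
    and z :: "real ^ 'n \<Rightarrow> real ^ 'n" +
  fixes f :: "real ^ 'n"
  assumes f_interior: "v \<in> V \<Longrightarrow> 0 < g v \<bullet> f + c v"

sublocale tiled_simplex \<subseteq> gauge_frame V g c f
  by unfold_locales (use f_interior no_interior_integer in auto)

section \<open>Tiles, and how their integer translates cover the space without overlap\<close>

context tiled_simplex
begin

text \<open>The coordinate of \<open>r\<close> at \<open>l - f\<close> with respect to the basis of all \<open>v - f\<close> with
  \<open>v \<noteq> k\<close>.\<close>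

definition coord :: "real ^ 'n \<Rightarrow> real ^ 'n \<Rightarrow> real ^ 'n \<Rightarrow> real" where
  "coord k l r = g l \<bullet> r - L l f / L k f * (g k \<bullet> r)"

text \<open>A parallelepiped with opposite corners 0 and \<open>z k - f\<close>. It consists of the
  \<open>r\<close> for which both \<open>r\<close> and \<open>z k - f - r\<close> lie in the cone
  spanned by the \<open>v - f\<close> with \<open>v \<noteq> k\<close>, where the gauge is
  \<open>slope k\<close>.\<close>

definition tile :: "real ^ 'n \<Rightarrow> (real ^ 'n) set" where
  "tile k = {r. \<forall>l\<in>V-{k}. 0 \<le> coord k l r \<and> coord k l r \<le> L l (z k)}"

lemma coord_add: "coord k l (x + y) = coord k l x + coord k l y"
  by (simp add: coord_def inner_add_right distrib_left)

lemma coord_diff: "coord k l (x - y) = coord k l x - coord k l y"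
  by (simp add: coord_def inner_diff_right right_diff_distrib)

lemma coord_scale: "coord k l (a *\<^sub>R x) = a * coord k l x"
  by (simp add: coord_def right_diff_distrib)

lemma coord_sum: "coord k l (\<Sum>i\<in>I. h i) = (\<Sum>i\<in>I. coord k l (h i))"
  by (simp add: coord_def inner_sum_right sum_subtractf sum_distrib_left)

lemma coord_slope: "k \<in> V \<Longrightarrow> l \<in> V \<Longrightarrow> coord k l r = L l f * (slope k r - slope l r)"
  using Lf_pos[of k] by (simp add: coord_def g_slope[of k] g_slope[of l] algebra_simps)

lemma coord_target: "k \<in> V \<Longrightarrow> coord k l (z k - f) = L l (z k)"
  using Lf_pos[of k] by (simp add: coord_def g_diff Lz_0)

lemma coord_ray:
  assumes "k \<in> V" "l \<in> V" "m \<in> V" "l \<noteq> k"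
  shows "coord k l (m - f) = (if m = l then 1 else if m = k then - L l f / L k f else 0)"
  using assms Lf_pos[of k] Lf_pos[of l] by (auto simp: coord_def g_diff L_vertex field_simps)

lemma coord_complement: "k \<in> V \<Longrightarrow> coord k l (z k - f - r) = L l (z k) - coord k l r"
  by (simp add: coord_diff[of _ _ "z k - f"] coord_target)

lemma coord_nonneg_gauge:
  assumes "k \<in> V" "\<And>l. l \<in> V - {k} \<Longrightarrow> 0 \<le> coord k l r"
  shows "\<psi> r = slope k r"
proof (rule \<psi>_eq)
  fix l assume l: "l \<in> V"
  show "slope l r \<le> slope k r"
  proof (cases "l = k")
    case False
    then show ?thesis
      using assms(2)[of l] assms(1) l Lf_pos[OF l] by (simp add: coord_slope zero_le_mult_iff)
  qed simp
qed fact

text \<open>Equal coordinates make all slopes of \<open>x - y\<close> agree, and the positive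
  relation \<open>sum_slope\<close> then forces them to vanish.\<close>

lemma coord_ext:
  assumes k: "k \<in> V" and eq: "\<And>l. l \<in> V - {k} \<Longrightarrow> coord k l x = coord k l y"
  shows "x = y"
proof -
  let ?d = "x - y"
  have const: "slope l ?d = slope k ?d" if l: "l \<in> V" for l
  proof (cases "l = k")
    case False
    then have "coord k l ?d = 0" using eq l by (simp add: coord_diff)
    then show ?thesis using l k Lf_pos[OF l] by (simp add: coord_slope)
  qed simp
  have "(\<Sum>v\<in>V. L v f * slope v ?d) = (\<Sum>v\<in>V. L v f * slope k ?d)"
    using const by (intro sum.cong) auto
  then have "(\<Sum>v\<in>V. L v f * slope v ?d) = (\<Sum>v\<in>V. L v f) * slope k ?d"
    by (simp add: sum_distrib_right)
  then have "slope k ?d = 0" by (simp add: sum_slope sum_L)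
  moreover obtain m where "m \<in> V" "\<psi> ?d = slope m ?d" using \<psi>_attained by blast
  ultimately have "\<psi> ?d = 0" using const by simp
  then show ?thesis using gauge_norm[of ?d] by simp
qed

lemma tile_gauge:
  assumes k: "k \<in> V" and r: "r \<in> tile k"
  shows "\<psi> r = slope k r" "\<psi> (z k - f - r) = 1 - slope k r"
proof -
  show "\<psi> r = slope k r" using k r by (intro coord_nonneg_gauge) (auto simp: tile_def)
  have "\<psi> (z k - f - r) = slope k (z k - f - r)"
    using k r by (intro coord_nonneg_gauge) (auto simp: tile_def coord_complement)
  then show "\<psi> (z k - f - r) = 1 - slope k r"
    by (simp add: slope_diff[of k "z k - f"] slope_to_f k Lz_0)
qed

lemma tile_bounded:
  assumes "k \<in> V" "r \<in> tile k"
  shows "norm r \<le> (\<Sum>v\<in>V. norm v)"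
proof -
  have "\<psi> r \<le> 1" using tile_gauge[OF assms] gauge_nonneg[of "z k - f - r"] by simp
  then have "(\<Sum>v\<in>V. norm v) * \<psi> r \<le> (\<Sum>v\<in>V. norm v) * 1"
    by (intro mult_left_mono sum_nonneg) auto
  then show ?thesis using gauge_norm[of r] by simp
qed

lemma closed_translated_tile: "closed {p. p - w \<in> tile k}"
proof -
  have "{p. p - w \<in> tile k}
      = (\<Inter>l\<in>V-{k}. {p. 0 \<le> coord k l (p - w)} \<inter> {p. coord k l (p - w) \<le> L l (z k)})"
    by (auto simp: tile_def)
  also have "closed \<dots>"
    unfolding coord_def by (intro closed_INT ballI closed_Int closed_Collect_le continuous_intros)
  finally show ?thesis .
qed

text \<open>The best translates of \<open>r\<close> and \<open>- f - r\<close> add up to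
  \<open>y - f\<close> with \<open>y\<close> integer. Their gauges sum to at most 1, so both are
  attained on one common facet \<open>k\<close>; the absence of ties puts \<open>y\<close> in its
  relative interior, hence \<open>y = z k\<close>.\<close>

lemma generic_in_tile:
  assumes cov: "trivial_lifting r + trivial_lifting (- f - r) \<le> 1"
    and gen: "\<And>w k l. w \<in> integer_points \<Longrightarrow> k \<in> V \<Longrightarrow> l \<in> V \<Longrightarrow> k \<noteq> l \<Longrightarrow> slope k (r + w) \<noteq> slope l (r + w)"
  shows "\<exists>k\<in>V. \<exists>w\<in>integer_points. r - w \<in> tile k"
proof -
  obtain w1 where w1: "w1 \<in> integer_points" "trivial_lifting r = \<psi> (r + w1)"
    by (rule trivial_lifting_attained)
  obtain w2 where w2: "w2 \<in> integer_points" "trivial_lifting (- f - r) = \<psi> (- f - r + w2)"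
    by (rule trivial_lifting_attained)
  define r1 where "r1 = r + w1"
  define y where "y = w1 + w2"
  have y: "y \<in> integer_points" using w1 w2 by (auto simp: y_def)
  have "- f - r + w2 = y - f - r1" by (simp add: y_def r1_def)
  then have le1: "\<psi> r1 + \<psi> (y - f - r1) \<le> 1" using cov w1(2) w2(2) r1_def by metis
  have ge1: "1 \<le> \<psi> (y - f)" using y by (rule gauge_integer)
  obtain k where k: "k \<in> V" "\<psi> (y - f) = slope k (y - f)" using \<psi>_attained by blast
  have split: "slope v (y - f) = slope v r1 + slope v (y - f - r1)" for v
    by (simp add: slope_diff[of v "y - f"])
  \<comment> \<open>The slopes of the two pieces sum to at least 1 while their gauges sum to at most
    1, so equality holds throughout.\<close>
  have k_eq: "slope k r1 = \<psi> r1" "slope k (y - f - r1) = \<psi> (y - f - r1)" "slope k (y - f) = 1"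
    using split[of k] k le1 ge1 slope_le[OF k(1), of r1] slope_le[OF k(1), of "y - f - r1"] by linarith+
  have Lk: "L k y = 0" using k_eq(3) k Lf_pos[of k] by (simp add: slope_to_f)
  have Ll: "0 < L l y" if l: "l \<in> V" "l \<noteq> k" for l
  proof -
    have "slope l r1 < slope k r1"
      using gen[OF w1(1) k(1) l(1)] l slope_le[OF l(1), of r1] k_eq by (simp add: r1_def)
    moreover have "slope l (y - f - r1) \<le> slope k (y - f - r1)" using slope_le l k_eq by simp
    ultimately have "slope l (y - f) < 1" using split[of l] split[of k] k_eq by linarith
    then show ?thesis using l Lf_pos[of l] by (simp add: slope_to_f zero_less_divide_iff)
  qed
  have yz: "y = z k" using k(1) y Lk Ll by (rule eq_z)
  have "r1 \<in> tile k"
    unfolding tile_def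
  proof (intro CollectI ballI)
    fix l assume l: "l \<in> V - {k}"
    have a: "0 \<le> coord k l r1"
      using l k k_eq slope_le[of l r1] Lf_pos[of l] by (simp add: coord_slope)
    have b: "0 \<le> coord k l (z k - f - r1)"
      using l k k_eq slope_le[of l "y - f - r1"] Lf_pos[of l] by (simp add: coord_slope yz)
    show "0 \<le> coord k l r1 \<and> coord k l r1 \<le> L l (z k)"
      using a b k by (simp add: coord_complement)
  qed
  then have "r - (- w1) \<in> tile k" by (simp add: r1_def)
  then show ?thesis using k w1 by blast
qed

text \<open>An uncovered point has a neighbourhood missed by the finitely many closed tiles near it.
  That neighbourhood contains a generic point, which does lie in a tile.\<close>

lemma tiles_cover:
  assumes uniq: "\<exists>!\<pi>. minimal_lifting f \<psi> \<pi>"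
  shows "\<exists>k\<in>V. \<exists>w\<in>integer_points. p - w \<in> tile k"
proof (rule ccontr)
  assume none: "\<not> ?thesis"
  define M where "M = (\<Sum>v\<in>V. norm v)"
  \<comment> \<open>Tiles lie in a ball of radius \<open>M\<close>, so \<open>W\<close> contains
    every translate whose tile meets the unit ball around \<open>p\<close>.\<close>
  define W where "W = {w \<in> integer_points. norm (- p + w) \<le> M + 1}"
  have finW: "finite W" unfolding W_def by (rule finite_integer_points_bounded)
  define U where "U = ball p 1 - (\<Union>k\<in>V. \<Union>w\<in>W. {x. x - w \<in> tile k})"
  have "open U"
    unfolding U_def using finite_V finW
    by (intro open_Diff open_ball closed_UN ballI closed_translated_tile) auto
  moreover have "p \<in> U" using none by (auto simp: U_def W_def)
  then have "U \<noteq> {}" by blast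
  moreover define I where "I = {(w :: real ^ 'n, k, l). w \<in> integer_points \<and> k \<in> V \<and> l \<in> V \<and> k \<noteq> l}"
  have "countable I"
  proof (rule countable_subset)
    show "I \<subseteq> integer_points \<times> V \<times> V" by (auto simp: I_def)
    show "countable (integer_points \<times> V \<times> V)"
      using finite_V countable_integer_points by (intro countable_SIGMA) (auto intro: countable_finite)
  qed
  \<comment> \<open>The three families are the points violating the genericity conditions of
    \<open>covered_if_unique\<close>; the hyperplanes indexed by \<open>I\<close> are the ties
    between slopes.\<close>
  moreover define Y where "Y = (integer_points :: (real ^ 'n) set) \<union> (\<lambda>w. - f - w) ` integer_points
      \<union> (\<lambda>w. (1 / 2) *\<^sub>R (- f - w)) ` integer_points"
  have "countable Y" unfolding Y_def using countable_integer_points by auto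
  moreover define s where "s v = (- 1 / L v f) *\<^sub>R g v" for v
  have s: "s v \<bullet> x = slope v x" for v x by (simp add: s_def slope_def)
  have "s k - s l \<noteq> 0" if "k \<in> V" "l \<in> V" "k \<noteq> l" for k l
  proof
    assume "s k - s l = 0"
    then have "slope k (l - f) = slope l (l - f)" using s[of k] s[of l] by simp
    then show False using that Lf_pos[of l] by (simp add: slope_to_f L_vertex)
  qed
  ultimately have "\<exists>x\<in>U. x \<notin> Y \<and> (\<forall>i\<in>I. (case i of (w, k, l) \<Rightarrow> s k - s l) \<bullet> x \<noteq>
      (case i of (w, k, l) \<Rightarrow> (s l - s k) \<bullet> w))"
    by (intro exists_generic_point) (auto simp: I_def)
  then obtain x where x: "x \<in> U" "x \<notin> Y"
    and xI: "\<And>w k l. (w, k, l) \<in> I \<Longrightarrow> (s k - s l) \<bullet> x \<noteq> (s l - s k) \<bullet> w" by force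
  have "slope k (x + w) \<noteq> slope l (x + w)"
    if "w \<in> integer_points" "k \<in> V" "l \<in> V" "k \<noteq> l" for w k l
    using xI[of w k l] that by (auto simp: I_def s[symmetric] inner_add_right inner_diff_left)
  moreover have "trivial_lifting x + trivial_lifting (- f - x) \<le> 1"
  proof (rule covered_if_unique[OF uniq])
    show "x \<notin> integer_points" using x by (simp add: Y_def)
    show "- f - x \<notin> integer_points"
    proof
      assume "- f - x \<in> integer_points"
      then have "- f - (- f - x) \<in> Y" unfolding Y_def by blast
      then show False using x by simp
    qed
    show "- f - 2 *\<^sub>R x \<notin> integer_points"
    proof
      assume "- f - 2 *\<^sub>R x \<in> integer_points"
      then have "(1 / 2) *\<^sub>R (- f - (- f - 2 *\<^sub>R x)) \<in> Y" unfolding Y_def by blast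
      then show False using x by simp
    qed
  qed
  ultimately obtain k w where kw: "k \<in> V" "w \<in> integer_points" "x - w \<in> tile k"
    using generic_in_tile by blast
  have "norm (x - w) \<le> M" using tile_bounded kw unfolding M_def by blast
  moreover have "norm (p - x) < 1" using x by (auto simp: U_def dist_norm)
  moreover have "norm (- p + w) \<le> norm (p - x) + norm (x - w)"
    using norm_triangle_ineq[of "p - x" "x - w"] norm_minus_commute[of p w] by simp
  ultimately have "w \<in> W" using kw by (simp add: W_def)
  then show False using x kw by (auto simp: U_def)
qed

definition tile_interior :: "real ^ 'n \<Rightarrow> (real ^ 'n) set" where
  "tile_interior k = {r. \<forall>l\<in>V-{k}. 0 < coord k l r \<and> coord k l r < L l (z k)}"

lemma tile_interior_subset: "tile_interior k \<subseteq> tile k"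
  by (auto simp: tile_interior_def tile_def intro: less_imp_le)

lemma coord_pos_slope_less:
  assumes "k \<in> V" "l \<in> V - {k}" "0 < coord k l r"
  shows "slope l r < slope k r"
  using assms Lf_pos[of l] by (simp add: coord_slope zero_less_mult_iff)

text \<open>For tiles of different type, \<open>r + (z k' - f - r')\<close> is an integer point
  minus \<open>f\<close>, so its gauge is at least 1. Strictness inside the tiles turns this into
  \<open>slope k' r' < slope k r\<close>, and by symmetry into the opposite. Tiles of the same type
  yield a second integer point inside the facet.\<close>

lemma tile_interiors_disjoint:
  assumes k: "k \<in> V" "k' \<in> V" and w: "w \<in> integer_points" "w' \<in> integer_points"
    and r: "p - w \<in> tile_interior k" "p - w' \<in> tile_interior k'"
  shows "k = k' \<and> w = w'"
proof -
  have less: "slope k' r' < slope k r"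
    if k: "k \<in> V" "k' \<in> V" and ne: "k \<noteq> k'" and r: "r \<in> tile_interior k" "r' \<in> tile_interior k'"
      and int: "r' - r \<in> integer_points" for k k' r r'
  proof -
    let ?y = "z k' - f - r'"
    have "1 \<le> \<psi> (z k' - (r' - r) - f)"
      using k int z_integer by (intro gauge_integer) auto
    also have "z k' - (r' - r) - f = r + ?y" by simp
    also have "\<psi> (r + ?y) < slope k r + slope k' ?y"
    proof -
      obtain m where m: "m \<in> V" "\<psi> (r + ?y) = slope m (r + ?y)" using \<psi>_attained by blast
      have a: "slope m r < slope k r" if "m \<noteq> k"
        using r(1) that m k by (intro coord_pos_slope_less) (auto simp: tile_interior_def)
      have b: "slope m ?y < slope k' ?y" if "m \<noteq> k'"
        using r(2) that m k by (intro coord_pos_slope_less) (auto simp: tile_interior_def coord_complement)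
      show ?thesis using a b ne m unfolding slope_add by (cases "m = k"; cases "m = k'") auto
    qed
    also have "slope k' ?y = 1 - slope k' r'"
      by (simp add: slope_diff[of k' "z k' - f"] slope_to_f k Lz_0)
    finally show ?thesis by simp
  qed
  have same: "k = k'"
  proof (rule ccontr)
    assume "k \<noteq> k'"
    then have "slope k' (p - w') < slope k (p - w)" "slope k (p - w) < slope k' (p - w')"
      using less[OF k _ r] less[OF k(2,1) _ r(2,1)] w by auto
    then show False by simp
  qed
  have le: "slope k r' \<le> slope k r"
    if r: "r \<in> tile_interior k" "r' \<in> tile_interior k" and int: "r' - r \<in> integer_points" for r r'
  proof -
    have "1 \<le> \<psi> (z k - (r' - r) - f)"
      using k int z_integer by (intro gauge_integer) auto
    also have "z k - (r' - r) - f = r + (z k - f - r')" by simp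
    also have "\<psi> \<dots> \<le> \<psi> r + \<psi> (z k - f - r')" by (rule gauge_add)
    also have "\<dots> = slope k r + (1 - slope k r')"
      using tile_gauge(1)[of k r] tile_gauge(2)[of k r'] k(1) r
        subsetD[OF tile_interior_subset] by simp
    finally show ?thesis by simp
  qed
  have "slope k (p - w) = slope k (p - w')"
    using le[of "p - w" "p - w'"] le[of "p - w'" "p - w"] r w same by (auto intro: antisym)
  then have gk: "g k \<bullet> (w - w') = 0" using k by (simp add: g_slope slope_diff)
  \<comment> \<open>Both coordinates at \<open>u\<close> lie strictly between 0 and
    \<open>L u (z k)\<close>, so their difference cannot push \<open>L u (z k)\<close> down to
    0.\<close>
  have "z k + (w - w') = z k"
  proof (rule eq_z)
    show "L k (z k + (w - w')) = 0" using gk k by (simp add: L_add Lz_0)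
    show "z k + (w - w') \<in> integer_points" using k z_integer w by auto
    fix u assume u: "u \<in> V" "u \<noteq> k"
    have "g u \<bullet> (w - w') = coord k u (p - w') - coord k u (p - w)"
      using gk by (simp add: coord_def inner_diff_right algebra_simps)
    then show "0 < L u (z k + (w - w'))"
      using r u same by (auto simp: L_add tile_interior_def dest!: bspec[of _ _ u])
  qed fact
  then show ?thesis using same by simp
qed

end

section \<open>Counting corners of tiles\<close>

lemma of_bool_Ball:
  "finite S \<Longrightarrow> (of_bool (\<forall>l\<in>S. P l) :: 'a :: comm_semiring_1) = (\<Prod>l\<in>S. of_bool (P l))"
  by (induction S rule: finite_induct) (simp_all add: of_bool_conj)

text \<open>Expanding the product on the right, \<open>A\<close> records the factors from which the
  subtracted term is chosen.\<close>

lemma alternating_sum_prod: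
  fixes h :: "'a \<Rightarrow> bool \<Rightarrow> 'b :: comm_ring_1"
  assumes "finite U"
  shows "(\<Sum>A\<in>Pow U. (- 1) ^ card A * (\<Prod>l\<in>U. h l (l \<in> A))) = (\<Prod>l\<in>U. h l False - h l True)"
proof -
  have "(\<Prod>l\<in>U. h l False - h l True) = (\<Prod>l\<in>U. - h l True + h l False)" by simp
  also have "\<dots> = (\<Sum>A\<in>Pow U. (\<Prod>l\<in>A. - h l True) * (\<Prod>l\<in>U-A. h l False))"
    by (rule prod_add[OF assms])
  also have "\<dots> = (\<Sum>A\<in>Pow U. (- 1) ^ card A * (\<Prod>l\<in>U. h l (l \<in> A)))"
  proof (rule sum.cong)
    fix A assume "A \<in> Pow U"
    then have A: "A \<subseteq> U" by blast
    have "(\<Prod>l\<in>A. - h l True) = (- 1) ^ card A * (\<Prod>l\<in>A. h l True)"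
      by (simp add: prod_uminus)
    moreover have "(\<Prod>l\<in>U. h l (l \<in> A)) = (\<Prod>l\<in>U-A. h l False) * (\<Prod>l\<in>A. h l True)"
    proof -
      have "(\<Prod>l\<in>U-A. h l (l \<in> A)) = (\<Prod>l\<in>U-A. h l False)" by (intro prod.cong) auto
      moreover have "(\<Prod>l\<in>A. h l (l \<in> A)) = (\<Prod>l\<in>A. h l True)" by (intro prod.cong) auto
      ultimately show ?thesis using prod.subset_diff[OF A assms, of "\<lambda>l. h l (l \<in> A)"] by simp
    qed
    ultimately show "(\<Prod>l\<in>A. - h l True) * (\<Prod>l\<in>U-A. h l False)
        = (- 1) ^ card A * (\<Prod>l\<in>U. h l (l \<in> A))"
      by (simp add: mult_ac)
  qed simp
  finally show ?thesis by simp
qed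

text \<open>The sets \<open>A\<close> and \<open>insert i A\<close> carry opposite signs and cancel
  in pairs.\<close>

lemma alternating_sum_cancel:
  fixes G :: "'a set \<Rightarrow> 'b :: comm_ring_1"
  assumes "finite U" "i \<in> U" and G: "\<And>A. A \<subseteq> U - {i} \<Longrightarrow> G (insert i A) = G A"
  shows "(\<Sum>A\<in>Pow U. (- 1) ^ card A * G A) = 0"
proof -
  let ?P = "Pow (U - {i})" and ?t = "\<lambda>A. (- 1) ^ card A * G A"
  have U: "U = insert i (U - {i})" using assms by blast
  have "(\<Sum>A\<in>Pow U. ?t A) = (\<Sum>A\<in>?P \<union> insert i ` ?P. ?t A)"
    by (subst U, subst Pow_insert) simp
  also have "\<dots> = (\<Sum>A\<in>?P. ?t A) + (\<Sum>A\<in>insert i ` ?P. ?t A)"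
    using assms by (intro sum.union_disjoint) auto
  also have "(\<Sum>A\<in>insert i ` ?P. ?t A) = (\<Sum>A\<in>?P. ?t (insert i A))"
    by (subst sum.reindex) (auto simp: inj_on_def)
  also have "\<dots> = (\<Sum>A\<in>?P. - ?t A)"
  proof (rule sum.cong)
    fix A assume A: "A \<in> ?P"
    then have "finite A" "i \<notin> A" using assms(1) finite_subset by auto
    then show "?t (insert i A) = - ?t A" using G[of A] A by simp
  qed simp
  finally show ?thesis by (simp add: sum_negf)
qed

text \<open>Whether moving from \<open>t\<close> a little upwards (\<open>up\<close>) or downwards stays in \<open>[0, b]\<close>.\<close>

definition stays_between :: "real \<Rightarrow> real \<Rightarrow> bool \<Rightarrow> bool" where
  "stays_between b t up \<longleftrightarrow> (t = 0 \<and> up) \<or> (t = b \<and> \<not> up) \<or> (0 < t \<and> t < b)"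

lemma eventually_stays_between:
  fixes t d b :: real
  assumes "d \<noteq> 0" "0 < b"
  shows "\<forall>\<^sub>F e in at_right 0.
     (0 \<le> t + e * d \<and> t + e * d \<le> b \<longleftrightarrow> stays_between b t (0 < d)) \<and> t + e * d \<noteq> 0 \<and> t + e * d \<noteq> b"
proof -
  define S where "S = {1, t, t - b, b} - {0}"
  \<comment> \<open>A shift smaller than every nonzero distance from \<open>t\<close> to the
    endpoints, and than \<open>b\<close> itself, cannot cross or reach a new endpoint.\<close>
  define m where "m = Min (abs ` S)"
  have S: "finite S" "1 \<in> S" "0 \<notin> S" by (auto simp: S_def)
  have "Min (abs ` S) \<in> abs ` S" using S by (intro Min_in) auto
  then have "0 < m" using S unfolding m_def by force
  moreover have le: "m \<le> \<bar>y\<bar>" if "y \<in> S" for y using S that by (auto simp: m_def)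
  ultimately have m: "0 < m" "t \<noteq> 0 \<Longrightarrow> m \<le> \<bar>t\<bar>" "t \<noteq> b \<Longrightarrow> m \<le> \<bar>t - b\<bar>" "m \<le> \<bar>b\<bar>"
    using assms le[of t] le[of "t - b"] le[of b] by (auto simp: S_def)
  have "\<forall>\<^sub>F e in at_right 0. e < m / \<bar>d\<bar>"
    using m assms by (intro eventually_at_rightI[of 0 "m / \<bar>d\<bar>"]) auto
  moreover have "\<forall>\<^sub>F e in at_right (0::real). 0 < e" by (simp add: eventually_at_right_less)
  ultimately show ?thesis
  proof eventually_elim
    case (elim e)
    define s where "s = e * d"
    have "\<bar>s\<bar> < m" using elim assms by (simp add: s_def abs_mult pos_less_divide_eq)
    moreover have "s \<noteq> 0" "0 < s \<longleftrightarrow> 0 < d" using elim assms by (auto simp: s_def zero_less_mult_iff)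
    ultimately show ?case
      using m assms(2) unfolding s_def[symmetric] stays_between_def
      by (cases "t = 0"; cases "t = b"; cases "0 < d") (auto simp: abs_if split: if_splits)
  qed
qed

lemma of_bool_stays_between_diff:
  assumes "0 < b"
  shows "of_bool (stays_between b t False) - of_bool (stays_between b t True)
     = (if t = b then 1 else if t = 0 then - 1 else (0::real))"
  using assms by (auto simp: stays_between_def)

section \<open>Signed counts of the tile corners at a point\<close>

context tiled_simplex
begin

text \<open>Nonzero exactly if \<open>r\<close> is a corner of \<open>tile k\<close>; the sign is
  the parity of the number of vanishing coordinates.\<close>

definition corner :: "real ^ 'n \<Rightarrow> real ^ 'n \<Rightarrow> real" where
  "corner k r = (\<Prod>l\<in>V-{k}. if coord k l r = L l (z k) then 1 else if coord k l r = 0 then - 1 else 0)"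

definition nearby :: "real ^ 'n \<Rightarrow> (real ^ 'n) set" where
  "nearby x = {w \<in> integer_points. norm (- x + w) \<le> (\<Sum>v\<in>V. norm v) + 1}"

lemma finite_nearby: "finite (nearby x)"
  unfolding nearby_def by (rule finite_integer_points_bounded)

lemma tile_nearby:
  assumes "k \<in> V" "w \<in> integer_points" "p - w \<in> tile k" "norm (p - x) \<le> 1"
  shows "w \<in> nearby x"
proof -
  have "- x + w = (p - x) - (p - w)" by simp
  then have "norm (- x + w) \<le> norm (p - x) + norm (p - w)" by (metis norm_triangle_ineq4)
  then show ?thesis using assms tile_bounded[of k "p - w"] by (simp add: nearby_def)
qed

text \<open>Sampling the tiling at \<open>x + \<epsilon> D A\<close>, the alternating sum over the sign patterns \<open>A\<close> kills every
  tile that does not have \<open>x\<close> as a corner, and every tile not of type \<open>i\<close> or \<open>i'\<close>.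
  The small factor \<open>\<kappa>\<close> puts the sample points close to the hyperplane separating the
  tiles of these two types.\<close>

lemma corner_sums_eq:
  assumes cover: "\<And>p. \<exists>k\<in>V. \<exists>w\<in>integer_points. p - w \<in> tile k"
    and distinct: "\<And>l m. l \<in> V \<Longrightarrow> m \<in> V \<Longrightarrow> l \<noteq> m \<Longrightarrow> L l f \<noteq> L m f"
    and i: "i \<in> V" "i' \<in> V" "i \<noteq> i'"
  shows "(\<Sum>w\<in>nearby x. corner i (x - w)) = (\<Sum>w\<in>nearby x. corner i' (x - w))"
proof -
  define U where "U = V - {i'}"
  have U: "finite U" "i \<in> U" "U \<subseteq> V" using finite_V i by (auto simp: U_def)
  define \<delta> where "\<delta> = Min ((\<lambda>v. L v f) ` V)"
  have \<delta>_le: "\<delta> \<le> L v f" if "v \<in> V" for v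
    using that finite_V by (auto simp: \<delta>_def)
  have "\<delta> \<in> (\<lambda>v. L v f) ` V" unfolding \<delta>_def using finite_V V_nonempty by (intro Min_in) auto
  then have \<delta>_pos: "0 < \<delta>" using Lf_pos by auto
  \<comment> \<open>With this choice \<open>\<kappa>\<close> is below every ratio
    \<open>\<rho> k l\<close>, and its product with any of them is below 1.\<close>
  define \<kappa> where "\<kappa> = \<delta> / 2"
  have \<kappa>: "0 < \<kappa>" using \<delta>_pos by (simp add: \<kappa>_def)
  define \<rho> where "\<rho> k l = L l f / L k f" for k l
  have \<rho>_pos: "0 < \<rho> k l" if "k \<in> V" "l \<in> V" for k l using that Lf_pos by (simp add: \<rho>_def)
  have \<kappa>_less: "\<kappa> < \<rho> k l" "\<rho> k l * \<kappa> < 1" if kl: "k \<in> V" "l \<in> V" for k l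
  proof -
    have "\<kappa> * L k f \<le> \<kappa> * 1" using kl \<kappa> Lf_le_1 by (intro mult_left_mono) auto
    also have "\<dots> < L l f" using \<delta>_le[OF kl(2)] \<delta>_pos by (simp add: \<kappa>_def)
    finally show "\<kappa> < \<rho> k l" using Lf_pos[OF kl(1)] by (simp add: \<rho>_def pos_less_divide_eq)
    have "L l f * \<kappa> \<le> 1 * \<kappa>" using kl \<kappa> Lf_le_1 by (intro mult_right_mono) auto
    also have "\<dots> < L k f" using \<delta>_le[OF kl(1)] \<delta>_pos by (simp add: \<kappa>_def)
    finally show "\<rho> k l * \<kappa> < 1" using Lf_pos[OF kl(1)] by (simp add: \<rho>_def pos_divide_less_eq)
  qed
  have \<rho>_ne: "\<rho> k l \<noteq> 1" if "k \<in> V" "l \<in> V" "k \<noteq> l" for k l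
    using distinct[OF that] Lf_pos[OF that(1)] by (simp add: \<rho>_def)
  \<comment> \<open>\<open>A\<close> lists the vertices towards which the sample point moves. There
    is no motion along \<open>i' - f\<close>, and only a small one along
    \<open>i - f\<close>.\<close>
  define d where "d A l = (if l = i' then 0 else (if l = i then \<kappa> else 1) * (if l \<in> A then 1 else - 1))"
    for A l
  define D where "D A = (\<Sum>l\<in>V. d A l *\<^sub>R (l - f))" for A
  define dc where "dc A k l = coord k l (D A)" for A k l
  have dc_eq: "dc A k l = d A l - \<rho> k l * d A k" if kl: "k \<in> V" "l \<in> V - {k}" for A k l
  proof -
    have "dc A k l = (\<Sum>m\<in>V. d A m * (if m = l then 1 else if m = k then - \<rho> k l else 0))"
      unfolding dc_def D_def coord_sum coord_scale
      using kl by (intro sum.cong) (auto simp: coord_ray \<rho>_def)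
    also have "\<dots> = (\<Sum>m\<in>V. (if m = l then d A m else 0) + (if m = k then - \<rho> k l * d A m else 0))"
      using kl by (intro sum.cong) auto
    also have "\<dots> = d A l - \<rho> k l * d A k"
      using kl finite_V by (simp add: sum.distrib)
    finally show ?thesis .
  qed
  have dc_i': "dc A i' l = d A l" if "l \<in> U" for A l
    using that i by (simp add: dc_eq U_def) (simp add: d_def)
  have sign_i': "dc A i' l \<noteq> 0" "0 < dc A i' l \<longleftrightarrow> l \<in> A" if l: "l \<in> U" for A l
    using that \<kappa> by (auto simp: dc_i'[OF l] d_def U_def)
  \<comment> \<open>Seen from type \<open>i\<close>, the motion along \<open>i - f\<close> shows up
    as a reversed sign in the coordinate at \<open>i'\<close>. This reversal later gives
    \<open>Ti\<close> its minus sign.\<close>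
  have sign_i: "dc A i l \<noteq> 0" "0 < dc A i l \<longleftrightarrow> (if l = i' then i \<notin> A else l \<in> A)"
    if l: "l \<in> V - {i}" for A l
  proof -
    define y where "y = \<rho> i l * \<kappa>"
    have y: "0 < y" "y < 1" using \<kappa>_less(2)[of i l] \<kappa> \<rho>_pos[of i l] i l by (auto simp: y_def)
    have "dc A i l = d A l - y * (if i \<in> A then 1 else - 1)"
      using i l by (simp add: dc_eq y_def) (simp add: d_def)
    then show "dc A i l \<noteq> 0" "0 < dc A i l \<longleftrightarrow> (if l = i' then i \<notin> A else l \<in> A)"
      using y l by (auto simp: d_def)
  qed
  \<comment> \<open>For the remaining types the motion along \<open>i - f\<close> is too small to
    affect any sign, and \<open>\<rho>_ne\<close>, which comes from \<open>distinct\<close>,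
    prevents the unit motions from cancelling.\<close>
  have sign_other: "dc A k l \<noteq> 0" "0 < dc (insert i A) k l \<longleftrightarrow> 0 < dc A k l"
    if k: "k \<in> V" "k \<noteq> i" "k \<noteq> i'" and l: "l \<in> V - {k}" for A k l
    using \<kappa>_less(1)[of k i] \<kappa> \<rho>_pos[of k l] \<rho>_ne[of k l] i l k
    by (auto simp: dc_eq d_def algebra_simps)
  have dc_ne: "dc A k l \<noteq> 0" if "k \<in> V" "l \<in> V - {k}" for A k l
    using sign_i'(1)[of l A] sign_i(1)[of l A] sign_other(1)[of k l A] that by (auto simp: U_def)
  define t where "t k w l = coord k l (x - w)" for k w l
  define P where "P e A k w l \<longleftrightarrow> (0 \<le> t k w l + e * dc A k l \<and> t k w l + e * dc A k l \<le> L l (z k)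
      \<longleftrightarrow> stays_between (L l (z k)) (t k w l) (0 < dc A k l))
      \<and> t k w l + e * dc A k l \<noteq> 0 \<and> t k w l + e * dc A k l \<noteq> L l (z k)" for e A k w l
  \<comment> \<open>Only finitely many conditions are involved, so one small \<open>e\<close>
    satisfies all of them.\<close>
  have "\<forall>\<^sub>F e in at_right 0. \<forall>A\<in>Pow U. \<forall>k\<in>V. \<forall>w\<in>nearby x. \<forall>l\<in>V-{k}. P e A k w l"
    unfolding P_def
    using finite_V U finite_nearby dc_ne Lz_pos
    by (intro eventually_ball_finite ballI eventually_stays_between) auto
  moreover have "\<forall>\<^sub>F e in at_right 0. \<forall>A\<in>Pow U. norm (e *\<^sub>R D A) \<le> 1"
  proof (intro eventually_ball_finite ballI)
    fix A
    have "((\<lambda>e. norm (e *\<^sub>R D A)) \<longlongrightarrow> norm (0 *\<^sub>R D A)) (at_right 0)" by (intro tendsto_intros)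
    then have "\<forall>\<^sub>F e in at_right 0. norm (e *\<^sub>R D A) < 1" by (rule order_tendstoD) simp
    then show "\<forall>\<^sub>F e in at_right 0. norm (e *\<^sub>R D A) \<le> 1" by eventually_elim simp
  qed (use U in simp)
  ultimately have "\<forall>\<^sub>F e in at_right (0::real). (\<forall>A\<in>Pow U. \<forall>k\<in>V. \<forall>w\<in>nearby x. \<forall>l\<in>V-{k}. P e A k w l)
      \<and> (\<forall>A\<in>Pow U. norm (e *\<^sub>R D A) \<le> 1)" by eventually_elim simp
  from eventually_happens'[OF trivial_limit_at_right_real this]
  obtain e where e': "\<forall>A\<in>Pow U. \<forall>k\<in>V. \<forall>w\<in>nearby x. \<forall>l\<in>V-{k}. P e A k w l"
      "\<forall>A\<in>Pow U. norm (e *\<^sub>R D A) \<le> 1"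
    by (elim exE conjE)
  have e: "P e A k w l" if "A \<subseteq> U" "k \<in> V" "w \<in> nearby x" "l \<in> V - {k}" for A k w l
    using bspec[OF bspec[OF bspec[OF bspec[OF e'(1)]]]] that by blast
  have norm_D: "norm (e *\<^sub>R D A) \<le> 1" if "A \<subseteq> U" for A
    using bspec[OF e'(2)] that by blast
  define p where "p A = x + e *\<^sub>R D A" for A
  have coord_p: "coord k l (p A - w) = t k w l + e * dc A k l" for A k l w
  proof -
    have "p A - w = (x - w) + e *\<^sub>R D A" by (simp add: p_def)
    then show ?thesis by (simp only: coord_add coord_scale t_def dc_def)
  qed
  define Q where "Q A k w \<longleftrightarrow> (\<forall>l\<in>V-{k}. stays_between (L l (z k)) (t k w l) (0 < dc A k l))" for A k w
  have tile_Q: "p A - w \<in> tile k \<longleftrightarrow> Q A k w" and tile_int: "p A - w \<in> tile k \<Longrightarrow> p A - w \<in> tile_interior k"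
    if "A \<subseteq> U" "k \<in> V" "w \<in> nearby x" for A k w
  proof -
    have P: "P e A k w l" if "l \<in> V - {k}" for l using e that \<open>A \<subseteq> U\<close> \<open>k \<in> V\<close> \<open>w \<in> nearby x\<close> by blast
    show "p A - w \<in> tile k \<longleftrightarrow> Q A k w"
      unfolding tile_def Q_def mem_Collect_eq coord_p using P[unfolded P_def] by blast
    show "p A - w \<in> tile k \<Longrightarrow> p A - w \<in> tile_interior k"
      unfolding tile_def tile_interior_def mem_Collect_eq coord_p
      using P[unfolded P_def] by (metis order_le_less)
  qed
  \<comment> \<open>Every sample point avoids the tile boundaries, so covering and disjoint
    interiors put it in exactly one tile. The alternating sum of these constant counts
    vanishes.\<close>
  have count: "(\<Sum>(k, w)\<in>V \<times> nearby x. of_bool (Q A k w)) = (1 :: real)" if A: "A \<subseteq> U" for A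
  proof -
    obtain k w where kw: "k \<in> V" "w \<in> integer_points" "p A - w \<in> tile k" using cover by blast
    have near: "w \<in> nearby x" using tile_nearby[OF kw] norm_D[OF A] by (simp add: p_def)
    have "Q A k' w' \<longleftrightarrow> (k', w') = (k, w)" if "k' \<in> V" "w' \<in> nearby x" for k' w'
    proof
      assume "Q A k' w'"
      then have "p A - w' \<in> tile_interior k'" using tile_Q tile_int A that by blast
      moreover have "p A - w \<in> tile_interior k" using tile_int A kw near by blast
      moreover have "w' \<in> integer_points" using that by (simp add: nearby_def)
      ultimately show "(k', w') = (k, w)" using tile_interiors_disjoint kw that by blast
    next
      assume "(k', w') = (k, w)"
      then show "Q A k' w'" using tile_Q[OF A] kw near by simp
    qed
    then have "(\<Sum>(k, w)\<in>V \<times> nearby x. of_bool (Q A k w))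
        = (\<Sum>y\<in>V \<times> nearby x. if y = (k, w) then 1 else (0 :: real))"
      by (intro sum.cong) (auto split: prod.splits)
    also have "\<dots> = 1" using kw near finite_V finite_nearby by (subst sum.delta) auto
    finally show ?thesis .
  qed
  define T where "T k w = (\<Sum>A\<in>Pow U. (- 1) ^ card A * (of_bool (Q A k w) :: real))" for k w
  have "(\<Sum>A\<in>Pow U. (- 1) ^ card A * (1 :: real)) = 0"
    using U by (intro alternating_sum_cancel[of U i]) auto
  then have "0 = (\<Sum>A\<in>Pow U. (- 1) ^ card A * (\<Sum>(k, w)\<in>V \<times> nearby x. of_bool (Q A k w) :: real))"
    using count by simp
  also have "\<dots> = (\<Sum>A\<in>Pow U. \<Sum>(k, w)\<in>V \<times> nearby x. (- 1) ^ card A * (of_bool (Q A k w) :: real))"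
    by (simp add: sum_distrib_left case_prod_unfold)
  also have "\<dots> = (\<Sum>(k, w)\<in>V \<times> nearby x. T k w)"
    unfolding T_def case_prod_unfold by (rule sum.swap)
  also have "\<dots> = (\<Sum>k\<in>V. \<Sum>w\<in>nearby x. T k w)"
    using finite_V finite_nearby by (simp add: sum.cartesian_product)
  also have "\<dots> = (\<Sum>k\<in>{i, i'}. \<Sum>w\<in>nearby x. T k w)"
  proof (rule sum.mono_neutral_right)
    show "\<forall>k\<in>V-{i, i'}. (\<Sum>w\<in>nearby x. T k w) = 0"
    proof
      fix k assume k: "k \<in> V - {i, i'}"
      have "T k w = 0" for w
        unfolding T_def
      proof (rule alternating_sum_cancel[OF U(1,2)])
        fix A assume "A \<subseteq> U - {i}"
        have "Q (insert i A) k w \<longleftrightarrow> Q A k w" unfolding Q_def using sign_other(2) k by simp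
        then show "of_bool (Q (insert i A) k w) = (of_bool (Q A k w) :: real)" by simp
      qed
      then show "(\<Sum>w\<in>nearby x. T k w) = 0" by simp
    qed
  qed (use finite_V i in auto)
  also have "\<dots> = (\<Sum>w\<in>nearby x. T i w) + (\<Sum>w\<in>nearby x. T i' w)" using i by simp
  finally have balance: "0 = (\<Sum>w\<in>nearby x. T i w) + (\<Sum>w\<in>nearby x. T i' w)" .
  have Ti': "T i' w = corner i' (x - w)" for w
  proof -
    let ?h = "\<lambda>l b. of_bool (stays_between (L l (z i')) (t i' w l) b) :: real"
    have "T i' w = (\<Sum>A\<in>Pow U. (- 1) ^ card A * (\<Prod>l\<in>U. ?h l (l \<in> A)))"
      unfolding T_def Q_def U_def[symmetric] using U sign_i'(2)
      by (intro sum.cong) (simp_all add: of_bool_Ball cong: prod.cong)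
    also have "\<dots> = (\<Prod>l\<in>U. ?h l False - ?h l True)" by (rule alternating_sum_prod[OF U(1)])
    also have "\<dots> = corner i' (x - w)"
      unfolding corner_def U_def[symmetric]
    proof (rule prod.cong)
      fix l assume "l \<in> U"
      then have "0 < L l (z i')" using i by (intro Lz_pos) (auto simp: U_def)
      then show "?h l False - ?h l True = (if coord i' l (x - w) = L l (z i') then 1
          else if coord i' l (x - w) = 0 then - 1 else 0)"
        by (simp only: of_bool_stays_between_diff t_def)
    qed simp
    finally show ?thesis .
  qed
  have Ti: "T i w = - corner i (x - w)" for w
  proof -
    let ?c = "\<lambda>l. if coord i l (x - w) = L l (z i) then 1
          else if coord i l (x - w) = 0 then - 1 else (0::real)"
    \<comment> \<open>The factor belonging to \<open>i'\<close> is stored at index \<open>i\<close>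
      with reversed direction, so that the product runs over \<open>U\<close> as
      \<open>alternating_sum_prod\<close> requires.\<close>
    define h where "h l b = (if l = i then of_bool (stays_between (L i' (z i)) (t i w i') (\<not> b))
        else of_bool (stays_between (L l (z i)) (t i w l) b) :: real)" for l b
    have diff: "of_bool (stays_between (L l (z i)) (t i w l) False)
        - of_bool (stays_between (L l (z i)) (t i w l) True) = ?c l" if "l \<in> V - {i}" for l
    proof -
      have "0 < L l (z i)" using i that by (intro Lz_pos) auto
      then show ?thesis by (simp only: of_bool_stays_between_diff t_def)
    qed
    have Vi: "V - {i} = insert i' (U - {i})" using i by (auto simp: U_def)
    have "T i w = (\<Sum>A\<in>Pow U. (- 1) ^ card A * (\<Prod>l\<in>U. h l (l \<in> A)))"
      unfolding T_def
    proof (intro sum.cong arg_cong2[where f = "(*)"] refl)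
      fix A
      have "of_bool (Q A i w) = (\<Prod>l\<in>V-{i}. of_bool (stays_between (L l (z i)) (t i w l) (0 < dc A i l)) :: real)"
        unfolding Q_def using finite_V by (simp add: of_bool_Ball)
      also have "\<dots> = (\<Prod>l\<in>insert i' (U-{i}). of_bool (stays_between (L l (z i)) (t i w l)
          (if l = i' then i \<notin> A else l \<in> A)))"
        unfolding Vi[symmetric] using sign_i(2) by (intro prod.cong) auto
      also have "\<dots> = h i (i \<in> A) * (\<Prod>l\<in>U-{i}. of_bool (stays_between (L l (z i)) (t i w l)
          (if l = i' then i \<notin> A else l \<in> A)))"
        using U by (subst prod.insert) (auto simp: h_def U_def)
      also have "\<dots> = h i (i \<in> A) * (\<Prod>l\<in>U-{i}. h l (l \<in> A))"
        by (intro arg_cong2[where f = "(*)"] prod.cong) (auto simp: h_def U_def)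
      also have "\<dots> = (\<Prod>l\<in>U. h l (l \<in> A))" using U by (subst prod.remove[of U i]) auto
      finally show "of_bool (Q A i w) = (\<Prod>l\<in>U. h l (l \<in> A))" .
    qed
    also have "\<dots> = (\<Prod>l\<in>U. h l False - h l True)" by (rule alternating_sum_prod[OF U(1)])
    also have "\<dots> = (h i False - h i True) * (\<Prod>l\<in>U-{i}. h l False - h l True)"
      using U by (subst prod.remove[of U i]) auto
    also have "h i False - h i True = - ?c i'" using diff[of i'] i by (simp add: h_def)
    also have "(\<Prod>l\<in>U-{i}. h l False - h l True) = (\<Prod>l\<in>U-{i}. ?c l)"
    proof (rule prod.cong)
      fix l assume "l \<in> U - {i}"
      then show "h l False - h l True = ?c l" using diff[of l] by (simp only: h_def U_def) auto
    qed simp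
    also have "- ?c i' * (\<Prod>l\<in>U-{i}. ?c l) = - corner i (x - w)"
      unfolding corner_def Vi using U by (subst prod.insert) (auto simp: U_def)
    finally show ?thesis .
  qed
  show ?thesis using balance unfolding Ti Ti' by (simp add: sum_negf)
qed

text \<open>A corner of a type \<open>k\<close> tile is a sum of
  \<open>L l (z k) *\<^sub>R (l - f)\<close> over some \<open>S\<close>. By \<open>gen\<close> the
  weights sum to \<open>\<mu>\<close>, and minimality of \<open>\<mu>\<close> leaves a single
  vertex. Such a corner has \<open>CARD('n) - 1\<close> vanishing coordinates, whence the
  sign.\<close>

lemma corner_sum_singletons:
  assumes k: "k \<in> V" and j0: "j0 \<in> V"
    and \<mu>: "0 < \<mu>" "\<And>k l. k \<in> V \<Longrightarrow> l \<in> V \<Longrightarrow> l \<noteq> k \<Longrightarrow> \<mu> \<le> L l (z k)"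
    and gen: "\<And>k S w. k \<in> V \<Longrightarrow> S \<subseteq> V \<Longrightarrow> w \<in> integer_points \<Longrightarrow>
      \<mu> *\<^sub>R (j0 - f) - w = (\<Sum>l\<in>S. L l (z k) *\<^sub>R (l - f)) \<Longrightarrow> (\<Sum>l\<in>S. L l (z k)) = \<mu>"
  shows "(\<Sum>w\<in>nearby (\<mu> *\<^sub>R (j0 - f)). corner k (\<mu> *\<^sub>R (j0 - f) - w))
    = (- 1) ^ (CARD('n) - 1) * real (card {j \<in> V - {k}. L j (z k) = \<mu> \<and> \<mu> *\<^sub>R (j0 - j) \<in> integer_points})"
proof -
  define x where "x = \<mu> *\<^sub>R (j0 - f)"
  define J where "J = {j \<in> V - {k}. L j (z k) = \<mu> \<and> \<mu> *\<^sub>R (j0 - j) \<in> integer_points}"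
  \<comment> \<open>Translating by \<open>h j\<close> turns the base point into
    \<open>\<mu> *\<^sub>R (j - f)\<close>.\<close>
  define h where "h j = \<mu> *\<^sub>R (j0 - j)" for j :: "real ^ 'n"
  have finJ: "finite J" using finite_V by (simp add: J_def)
  have inj: "inj_on h J" using \<mu>(1) by (auto simp: inj_on_def h_def)
  have x_h: "x - h j = \<mu> *\<^sub>R (j - f)" for j by (simp add: x_def h_def algebra_simps)
  have coord_h: "coord k l (x - h j) = (if l = j then \<mu> else 0)" if "j \<in> J" "l \<in> V - {k}" for j l
    unfolding x_h coord_scale using that k by (auto simp: J_def coord_ray)
  have near: "h j \<in> nearby x" if j: "j \<in> J" for j
  proof (rule tile_nearby[OF k])
    show "h j \<in> integer_points" using j by (simp add: J_def h_def)
    show "x - h j \<in> tile k"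
      unfolding tile_def using j coord_h[OF j] \<mu>(1) Lz_pos[OF _ k] by (auto simp: J_def intro: less_imp_le)
  qed simp
  have corner_h: "corner k (x - h j) = (- 1) ^ (CARD('n) - 1)" if j: "j \<in> J" for j
  proof -
    have jV: "j \<in> V - {k}" "L j (z k) = \<mu>" using j by (auto simp: J_def)
    have "corner k (x - h j) = (\<Prod>l\<in>V-{k}. if l = j then 1 else - 1)"
      unfolding corner_def
    proof (rule prod.cong)
      fix l assume l: "l \<in> V - {k}"
      have "L l (z k) \<noteq> 0" using Lz_pos[of l k] l k by simp
      then show "(if coord k l (x - h j) = L l (z k) then 1 else if coord k l (x - h j) = 0 then - 1 else 0)
          = (if l = j then 1 else - 1 :: real)"
        using coord_h[OF j l] jV by auto
    qed simp
    also have "\<dots> = (\<Prod>l\<in>V-{k}-{j}. - 1)"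
      using jV finite_V by (subst prod.remove[of _ j]) (auto intro!: prod.cong)
    also have "\<dots> = (- 1) ^ (CARD('n) - 1)"
      using jV k finite_V card_V by simp
    finally show ?thesis .
  qed
  have zero: "corner k (x - w) = 0" if w: "w \<in> nearby x - h ` J" for w
  proof (rule ccontr)
    assume "corner k (x - w) \<noteq> 0"
    then have nz: "coord k l (x - w) = L l (z k) \<or> coord k l (x - w) = 0" if "l \<in> V - {k}" for l
      using that finite_V unfolding corner_def by (fastforce simp: prod_zero_iff split: if_splits)
    define S where "S = {l \<in> V - {k}. coord k l (x - w) = L l (z k)}"
    have S: "S \<subseteq> V" "k \<notin> S" "finite S" using finite_V by (auto simp: S_def)
    have "x - w = (\<Sum>l\<in>S. L l (z k) *\<^sub>R (l - f))"
    proof (rule coord_ext[OF k])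
      fix l assume l: "l \<in> V - {k}"
      have "coord k l (\<Sum>l\<in>S. L l (z k) *\<^sub>R (l - f)) = (\<Sum>m\<in>S. if m = l then L l (z k) else 0)"
        unfolding coord_sum coord_scale
      proof (rule sum.cong)
        fix m assume "m \<in> S"
        then have "m \<in> V" "m \<noteq> k" using S by auto
        then show "L m (z k) * coord k l (m - f) = (if m = l then L l (z k) else 0)"
          using l k by (auto simp: coord_ray)
      qed simp
      also have "\<dots> = coord k l (x - w)" using S nz[OF l] l by (auto simp: S_def)
      finally show "coord k l (x - w) = coord k l (\<Sum>l\<in>S. L l (z k) *\<^sub>R (l - f))" by simp
    qed
    moreover have wint: "w \<in> integer_points" using w by (simp add: nearby_def)
    ultimately have sum_S: "(\<Sum>l\<in>S. L l (z k)) = \<mu>" and x_S: "x - w = (\<Sum>l\<in>S. L l (z k) *\<^sub>R (l - f))"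
      using gen[OF k S(1) wint] by (auto simp: x_def)
    have "S \<noteq> {}" using sum_S \<mu>(1) by auto
    then obtain j where j: "j \<in> S" by blast
    have rest: "(\<Sum>l\<in>S. L l (z k)) = L j (z k) + (\<Sum>l\<in>S-{j}. L l (z k))"
      using S j by (intro sum.remove) auto
    have pos: "0 < L l (z k)" if "l \<in> S" for l using that S k by (intro Lz_pos) auto
    have "\<mu> \<le> L j (z k)" using \<mu>(2)[OF k] j S by auto
    have "S = {j}"
    proof (rule ccontr)
      assume "S \<noteq> {j}"
      then have "S - {j} \<noteq> {}" using j by blast
      then have "0 < (\<Sum>l\<in>S-{j}. L l (z k))" using S pos by (intro sum_pos) auto
      then show False using rest sum_S \<open>\<mu> \<le> L j (z k)\<close> by simp
    qed
    then have Lj: "L j (z k) = \<mu>" and "x - w = \<mu> *\<^sub>R (j - f)" using sum_S x_S by auto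
    then have "w = h j" using x_h[of j] by (metis diff_diff_eq2 add_diff_cancel_left' diff_add_cancel)
    moreover have "j \<in> J" using j S Lj wint \<open>w = h j\<close> by (auto simp: J_def h_def)
    ultimately show False using w by blast
  qed
  have "(\<Sum>w\<in>nearby x. corner k (x - w)) = (\<Sum>w\<in>h ` J. corner k (x - w))"
    using finite_nearby near zero by (intro sum.mono_neutral_right) auto
  also have "\<dots> = (\<Sum>j\<in>J. corner k (x - h j))" using inj by (simp add: sum.reindex)
  also have "\<dots> = (- 1) ^ (CARD('n) - 1) * real (card J)" using corner_h by simp
  finally show ?thesis unfolding x_def J_def .
qed

end

section \<open>From a generic tiling to barycentric facet points\<close>

context lattice_simplex
begin

text \<open>If the weights over \<open>S\<close> do not sum to \<open>\<mu>\<close>, the equation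
  determines \<open>f\<close>, which excludes only countably many points. Equal barycentric
  coordinates exclude finitely many hyperplanes.\<close>

lemma exists_generic_interior_point:
  "\<exists>f. (\<forall>v\<in>V. 0 < L v f) \<and> (\<forall>l\<in>V. \<forall>m\<in>V. l \<noteq> m \<longrightarrow> L l f \<noteq> L m f) \<and>
    (\<forall>k\<in>V. \<forall>S\<subseteq>V. \<forall>w\<in>integer_points.
      \<mu> *\<^sub>R (j0 - f) - w = (\<Sum>l\<in>S. L l (z k) *\<^sub>R (l - f)) \<longrightarrow> (\<Sum>l\<in>S. L l (z k)) = \<mu>)"
proof -
  define U where "U = {x. \<forall>v\<in>V. 0 < L v x}"
  have "U = (\<Inter>v\<in>V. {x. 0 < L v x})" by (auto simp: U_def)
  moreover have "open (\<Inter>v\<in>V. {x. 0 < L v x})"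
    unfolding L_def using finite_V by (intro open_INT ballI open_Collect_less continuous_intros) auto
  ultimately have "open U" by simp
  moreover have "U \<noteq> {}"
  proof -
    obtain k where k: "k \<in> V" using V_nonempty by blast
    let ?a = "1 / real (card V)"
    let ?b = "k + (\<Sum>u\<in>V. ?a *\<^sub>R (u - k))"
    have "L v ?b = ?a" if v: "v \<in> V" for v
    proof -
      have "L v ?b = L v k + (\<Sum>u\<in>V. ?a * (L v u - L v k))"
        by (simp add: L_add inner_sum_right g_diff)
      also have "(\<Sum>u\<in>V. ?a * (L v u - L v k)) = (\<Sum>u\<in>V. (if u = v then ?a else 0)) - (\<Sum>u\<in>V. ?a * L v k)"
        unfolding sum_subtractf[symmetric] using v L_vertex by (intro sum.cong) (auto simp: algebra_simps)
      also have "\<dots> = ?a - L v k" using v finite_V card_V by simp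
      finally show ?thesis by simp
    qed
    then have "?b \<in> U" using card_V by (simp add: U_def)
    then show ?thesis by blast
  qed
  moreover define I where "I = {(l, m). l \<in> V \<and> m \<in> V \<and> l \<noteq> m}"
  have "I \<subseteq> V \<times> V" by (auto simp: I_def)
  then have "countable I" using finite_V by (intro countable_finite) (auto intro: finite_subset)
  \<comment> \<open>\<open>y\<close> solves the equation for \<open>f\<close>, given
    \<open>k\<close>, \<open>S\<close> and \<open>w\<close>.\<close>
  moreover define y where "y = (\<lambda>(k, S, w). (1 / ((\<Sum>l\<in>S. L l (z k)) - \<mu>)) *\<^sub>R
      ((\<Sum>l\<in>S. L l (z k) *\<^sub>R l) - \<mu> *\<^sub>R j0 + w))"
  define Y where "Y = y ` (V \<times> Pow V \<times> integer_points)"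
  have "countable Y"
    unfolding Y_def using finite_V countable_integer_points
    by (intro countable_image countable_SIGMA) (auto intro: countable_finite)
  moreover have "g l - g m \<noteq> 0" if "l \<in> V" "m \<in> V" "l \<noteq> m" for l m
  proof
    assume "g l - g m = 0"
    then have "g l \<bullet> (l - m) = g m \<bullet> (l - m)" by simp
    then show False using that by (simp add: g_diff L_vertex)
  qed
  ultimately have "\<exists>x\<in>U. x \<notin> Y \<and> (\<forall>i\<in>I. (case i of (l, m) \<Rightarrow> g l - g m) \<bullet> x \<noteq> (case i of (l, m) \<Rightarrow> c m - c l))"
    by (intro exists_generic_point) (auto simp: I_def)
  then obtain f where f: "f \<in> U" "f \<notin> Y"
    and fI: "\<And>l m. (l, m) \<in> I \<Longrightarrow> (g l - g m) \<bullet> f \<noteq> c m - c l" by force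
  show ?thesis
  proof (intro exI[of _ f] conjI ballI allI impI)
    show "0 < L v f" if "v \<in> V" for v using that f by (simp add: U_def)
    show "L l f \<noteq> L m f" if "l \<in> V" "m \<in> V" "l \<noteq> m" for l m
      using fI[of l m] that by (auto simp: I_def L_def inner_diff_left)
  next
    fix k S w
    assume k: "k \<in> V" and S: "S \<subseteq> V" and w: "w \<in> integer_points"
      and eq: "\<mu> *\<^sub>R (j0 - f) - w = (\<Sum>l\<in>S. L l (z k) *\<^sub>R (l - f))"
    let ?s = "\<Sum>l\<in>S. L l (z k)"
    show "?s = \<mu>"
    proof (rule ccontr)
      assume ne: "?s \<noteq> \<mu>"
      have "(\<Sum>l\<in>S. L l (z k) *\<^sub>R (l - f)) = (\<Sum>l\<in>S. L l (z k) *\<^sub>R l) - ?s *\<^sub>R f"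
        by (simp add: scaleR_diff_right sum_subtractf scaleR_sum_left)
      then have "(?s - \<mu>) *\<^sub>R f = (\<Sum>l\<in>S. L l (z k) *\<^sub>R l) - \<mu> *\<^sub>R j0 + w"
        using eq by (simp add: algebra_simps)
      then have "y (k, S, w) = (1 / (?s - \<mu>)) *\<^sub>R ((?s - \<mu>) *\<^sub>R f)" by (simp add: y_def)
      also have "\<dots> = f" using ne by simp
      finally have "f \<in> Y" using k S w by (force simp: Y_def)
      then show False using f by simp
    qed
  qed
qed

text \<open>If \<open>j\<close> and \<open>l\<close> lie in \<open>C\<close>, then \<open>z k + \<mu> (j - l)\<close> is an integer point of the facet; by uniqueness of
  \<open>z k\<close> it is not in the relative interior, which forces \<open>L l (z k) = \<mu>\<close>.\<close>

lemma facet_points_barycentric: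
  assumes uniq: "\<And>f. \<forall>v\<in>V. 0 < L v f \<Longrightarrow> \<exists>!\<pi>. minimal_lifting f (gauge_frame.\<psi> V g c f) \<pi>"
    and k: "k \<in> V" and l: "l \<in> V" "l \<noteq> k"
  shows "L l (z k) = 1 / real CARD('n)"
proof -
  define E where "E = {(k, l). k \<in> V \<and> l \<in> V \<and> l \<noteq> k}"
  have "E \<subseteq> V \<times> V" by (auto simp: E_def)
  then have finE: "finite E" using finite_V by (auto intro: finite_subset)
  have "(k, l) \<in> E" using k l by (simp add: E_def)
  define \<mu> where "\<mu> = Min ((\<lambda>(k, l). L l (z k)) ` E)"
  have "\<mu> \<in> (\<lambda>(k, l). L l (z k)) ` E" unfolding \<mu>_def using finE \<open>(k, l) \<in> E\<close> by (intro Min_in) auto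
  then obtain i0 j0 where ij: "i0 \<in> V" "j0 \<in> V" "j0 \<noteq> i0" "L j0 (z i0) = \<mu>" by (auto simp: E_def)
  have \<mu>_pos: "0 < \<mu>" using Lz_pos[of j0 i0] ij by simp
  have \<mu>_le: "\<mu> \<le> L l (z k)" if "k \<in> V" "l \<in> V" "l \<noteq> k" for k l
    unfolding \<mu>_def using that finE by (intro Min_le) (auto simp: E_def)
  obtain f where f: "\<forall>v\<in>V. 0 < L v f"
      and distinct: "\<forall>l\<in>V. \<forall>m\<in>V. l \<noteq> m \<longrightarrow> L l f \<noteq> L m f"
      and gen: "\<forall>k\<in>V. \<forall>S\<subseteq>V. \<forall>w\<in>integer_points.
        \<mu> *\<^sub>R (j0 - f) - w = (\<Sum>l\<in>S. L l (z k) *\<^sub>R (l - f)) \<longrightarrow> (\<Sum>l\<in>S. L l (z k)) = \<mu>"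
    using exists_generic_interior_point[of \<mu> j0] by (elim exE conjE)
  interpret tiled_simplex V g c z f
    by unfold_locales (use f in \<open>simp add: L_def\<close>)
  have cover: "\<exists>k\<in>V. \<exists>w\<in>integer_points. p - w \<in> tile k" for p
    using uniq[of f] f by (intro tiles_cover) auto
  define J where "J k = {j \<in> V - {k}. L j (z k) = \<mu> \<and> \<mu> *\<^sub>R (j0 - j) \<in> integer_points}" for k
  have finJ: "finite (J k)" for k using finite_V by (simp add: J_def)
  have card_J: "card (J k) = card (J k')" if k: "k \<in> V" "k' \<in> V" for k k'
  proof (cases "k = k'")
    case False
    have "(- 1 :: real) ^ (CARD('n) - 1) * real (card (J k)) = (- 1) ^ (CARD('n) - 1) * real (card (J k'))"
      using corner_sums_eq[OF cover distinct[rule_format] k False, of "\<mu> *\<^sub>R (j0 - f)"]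
        corner_sum_singletons[OF k(1) ij(2) \<mu>_pos \<mu>_le gen[rule_format]] corner_sum_singletons[OF k(2) ij(2) \<mu>_pos \<mu>_le gen[rule_format]]
      by (simp add: J_def)
    then show ?thesis by simp
  qed simp
  define C where "C = {j \<in> V. \<mu> *\<^sub>R (j0 - j) \<in> integer_points}"
  have C: "finite C" "j0 \<in> C" "C \<subseteq> V" using finite_V ij by (auto simp: C_def)
  have J_full: "J k = C - {k}" if k: "k \<in> V" "J k \<noteq> {}" for k
  proof -
    obtain j where j: "j \<in> J k" using k by blast
    have jV: "j \<in> V" "j \<noteq> k" "L j (z k) = \<mu>" "\<mu> *\<^sub>R (j0 - j) \<in> integer_points" using j by (auto simp: J_def)
    have "L l (z k) = \<mu>" if l: "l \<in> C - {k}" for l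
    proof (rule ccontr)
      assume ne: "L l (z k) \<noteq> \<mu>"
      have lV: "l \<in> V" "l \<noteq> k" "\<mu> *\<^sub>R (j0 - l) \<in> integer_points" using l by (auto simp: C_def)
      have gt: "\<mu> < L l (z k)" using \<mu>_le[of k l] k lV ne by simp
      have lj: "l \<noteq> j" using ne jV by auto
      define d where "d = \<mu> *\<^sub>R (j - l)"
      have "d = \<mu> *\<^sub>R (j0 - l) - \<mu> *\<^sub>R (j0 - j)" by (simp add: d_def algebra_simps)
      then have dint: "d \<in> integer_points" using jV lV by auto
      have gd: "g v \<bullet> d = (if v = j then \<mu> else if v = l then - \<mu> else 0)" if "v \<in> V" for v
        using that jV lV lj by (simp add: d_def g_diff L_vertex)
      have "z k + d = z k"
      proof (rule eq_z[OF k(1)])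
        show "z k + d \<in> integer_points" using z_integer k dint by auto
        show "L k (z k + d) = 0" using k jV lV by (simp add: L_add Lz_0 gd)
        fix u assume u: "u \<in> V" "u \<noteq> k"
        then show "0 < L u (z k + d)" using gd[of u] Lz_pos[of u k] k gt \<mu>_pos by (auto simp: L_add)
      qed
      then show False using \<mu>_pos lj by (simp add: d_def)
    qed
    then show ?thesis using C by (auto simp: J_def C_def)
  qed
  have "j0 \<in> J i0" using ij by (simp add: J_def)
  \<comment> \<open>All \<open>J k\<close> have the same cardinality, so one nonempty instance makes
    every one of them nonempty and equal to \<open>C - {k}\<close>.\<close>
  then have "card (J i0) \<noteq> 0" using finJ by (metis card_0_eq empty_iff)
  then have J_eq: "J k = C - {k}" if "k \<in> V" for k
    using J_full[OF that] card_J[OF that ij(1)] by (metis card.empty)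
  \<comment> \<open>For a vertex \<open>k\<close> outside \<open>C\<close> the set
    \<open>J k\<close> would be all of \<open>C\<close>, one element more than
    \<open>J j0\<close>.\<close>
  have "C = V"
  proof (rule ccontr)
    assume "C \<noteq> V"
    then obtain k where k: "k \<in> V" "k \<notin> C" using C by blast
    then have "card (C - {k}) = card (C - {j0})" using card_J[OF k(1) ij(2)] J_eq ij by simp
    then show False using k C by (simp add: card_gt_0_iff) (metis C(1,2) Suc_pred card_gt_0_iff empty_iff lessI nat_neq_iff)
  qed
  then have "L j (z k) = \<mu>" if "j \<in> V - {k}" for j
    using J_eq[OF k] that by (auto simp: J_def)
  then have "(\<Sum>j\<in>V-{k}. L j (z k)) = (\<Sum>j\<in>V-{k}. \<mu>)" by (intro sum.cong) auto
  also have "\<dots> = real CARD('n) * \<mu>" using k finite_V card_V by simp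
  finally have "real CARD('n) * \<mu> = 1"
    using sum.remove[OF finite_V k, of "\<lambda>j. L j (z k)"] sum_L[of "z k"] Lz_0[OF k] by simp
  then show ?thesis
    using \<open>\<And>j. j \<in> V - {k} \<Longrightarrow> L j (z k) = \<mu>\<close>[of l] l by (simp add: field_simps)
qed

end

section \<open>Lattice simplices and unimodular maps\<close>

text \<open>The affine form for \<open>u\<close> is built from a linear functional on the edges at
  another vertex \<open>a\<close>: prescribed on the edge basis, it is 1 on the edge to
  \<open>u\<close> and 0 on the others.\<close>

lemma exists_affine_frame:
  fixes V :: "(real ^ 'n) set"
  assumes indep: "\<not> affine_dependent V" and card: "card V = CARD('n) + 1"
  shows "\<exists>g c. affine_frame V g c"
proof -
  have fin: "finite V" using indep by (rule aff_independent_finite)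
  have "\<exists>g c. \<forall>v\<in>V. g \<bullet> v + c = (if v = u then 1 else 0)" if u: "u \<in> V" for u
  proof -
    have "card (V - {u}) > 0" using u fin card by simp
    then obtain a where a: "a \<in> V" "a \<noteq> u" by (metis card_gt_0_iff Diff_iff ex_in_conv singletonI)
    let ?B = "(\<lambda>x. - a + x) ` (V - {a})"
    have "independent ?B" using indep affine_dependent_iff_dependent2[OF a(1)] by simp
    then obtain h :: "real ^ 'n \<Rightarrow> real" where h: "linear h" "\<And>x. x \<in> ?B \<Longrightarrow> h x = (if x = - a + u then 1 else 0)"
      using linear_independent_extend[of ?B "\<lambda>x. if x = - a + u then 1 else 0"] by blast
    have "adjoint h 1 \<bullet> x = h x" for x
      using adjoint_works[OF h(1), of x 1] by (simp add: inner_commute)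
    moreover have "h (v - a) = (if v = u then 1 else 0)" if "v \<in> V" for v
    proof (cases "v = a")
      case True
      then show ?thesis using a linear_0[OF h(1)] by simp
    next
      case False
      then have "h (- a + v) = (if - a + v = - a + u then 1 else 0)" using that by (intro h) auto
      then show ?thesis by simp
    qed
    ultimately have "\<forall>v\<in>V. adjoint h 1 \<bullet> v + (- (adjoint h 1 \<bullet> a)) = (if v = u then 1 else 0)"
      using linear_diff[OF h(1)] by simp
    then show ?thesis by blast
  qed
  then obtain g c where gc: "\<And>u v. u \<in> V \<Longrightarrow> v \<in> V \<Longrightarrow> g u \<bullet> v + c u = (if v = u then 1 else (0::real))"
    by metis
  have "aff_dim V = int CARD('n)" using aff_dim_affine_independent[OF indep] card by simp
  then have hull: "affine hull V = UNIV" using aff_dim_eq_full[of V] by simp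
  have coords: "(\<Sum>v\<in>V. g v \<bullet> x + c v) = 1 \<and> (\<Sum>v\<in>V. (g v \<bullet> x + c v) *\<^sub>R v) = x" for x
  proof -
    have "x \<in> affine hull V" using hull by simp
    then obtain t where t: "sum t V = 1" "(\<Sum>v\<in>V. t v *\<^sub>R v) = x"
      unfolding affine_hull_finite[OF fin] by blast
    have "g w \<bullet> x + c w = t w" if w: "w \<in> V" for w
    proof -
      have "g w \<bullet> x + c w = (\<Sum>v\<in>V. t v * (g w \<bullet> v)) + (\<Sum>v\<in>V. t v) * c w"
        unfolding t(2)[symmetric] using t(1) by (simp add: inner_sum_right)
      also have "\<dots> = (\<Sum>v\<in>V. t v * (g w \<bullet> v + c w))"
        by (simp add: sum_distrib_right sum.distrib distrib_left)
      also have "\<dots> = (\<Sum>v\<in>V. if v = w then t v else 0)" using gc w by (intro sum.cong) auto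
      also have "\<dots> = t w" using w fin by simp
      finally show ?thesis .
    qed
    then show ?thesis using t by simp
  qed
  have "affine_frame V g c"
    by unfold_locales (use fin card coords gc in auto)
  then show ?thesis by blast
qed

section \<open>Faces of the simplex in barycentric coordinates\<close>

context affine_frame
begin

lemma L_combination:
  assumes "S \<subseteq> V" "sum t S = 1" "v \<in> V"
  shows "L v (\<Sum>u\<in>S. t u *\<^sub>R u) = (if v \<in> S then t v else 0)"
proof -
  have fin: "finite S" using assms finite_V finite_subset by blast
  have "L v (\<Sum>u\<in>S. t u *\<^sub>R u) = (\<Sum>u\<in>S. t u * (g v \<bullet> u)) + (\<Sum>u\<in>S. t u) * c v"
    using assms by (simp add: L_def inner_sum_right)
  also have "\<dots> = (\<Sum>u\<in>S. t u * L v u)"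
    by (simp add: L_def sum_distrib_right sum.distrib distrib_left)
  also have "\<dots> = (\<Sum>u\<in>S. if u = v then t u else 0)"
    using assms L_vertex by (intro sum.cong) auto
  finally show ?thesis using fin by simp
qed

lemma repr_subset:
  assumes "S \<subseteq> V" "\<And>v. v \<in> V - S \<Longrightarrow> L v x = 0"
  shows "(\<Sum>v\<in>S. L v x) = 1" "(\<Sum>v\<in>S. L v x *\<^sub>R v) = x"
proof -
  have "(\<Sum>v\<in>S. L v x) = (\<Sum>v\<in>V. L v x)" using assms finite_V by (intro sum.mono_neutral_left) auto
  then show "(\<Sum>v\<in>S. L v x) = 1" by (simp add: sum_L)
  have "(\<Sum>v\<in>S. L v x *\<^sub>R v) = (\<Sum>v\<in>V. L v x *\<^sub>R v)" using assms finite_V by (intro sum.mono_neutral_left) auto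
  then show "(\<Sum>v\<in>S. L v x *\<^sub>R v) = x" by (simp add: repr_L)
qed

lemma convex_hull_subset_eq:
  assumes "S \<subseteq> V"
  shows "convex hull S = {x. (\<forall>v\<in>S. 0 \<le> L v x) \<and> (\<forall>v\<in>V-S. L v x = 0)}"
proof -
  have fin: "finite S" using assms finite_V finite_subset by blast
  show ?thesis
    unfolding convex_hull_finite[OF fin]
  proof (intro set_eqI iffI)
    fix x assume "x \<in> {y. \<exists>u. (\<forall>x\<in>S. 0 \<le> u x) \<and> sum u S = 1 \<and> (\<Sum>x\<in>S. u x *\<^sub>R x) = y}"
    then show "x \<in> {x. (\<forall>v\<in>S. 0 \<le> L v x) \<and> (\<forall>v\<in>V-S. L v x = 0)}"
      using L_combination[OF assms] assms by auto
  next
    fix x assume "x \<in> {x. (\<forall>v\<in>S. 0 \<le> L v x) \<and> (\<forall>v\<in>V-S. L v x = 0)}"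
    then show "x \<in> {y. \<exists>u. (\<forall>x\<in>S. 0 \<le> u x) \<and> sum u S = 1 \<and> (\<Sum>x\<in>S. u x *\<^sub>R x) = y}"
      using repr_subset[OF assms, of x] by (intro CollectI exI[of _ "\<lambda>v. L v x"]) auto
  qed
qed

lemma positive_combinations_eq:
  assumes "S \<subseteq> V"
  shows "{y. \<exists>t. (\<forall>x\<in>S. 0 < t x) \<and> sum t S = 1 \<and> (\<Sum>x\<in>S. t x *\<^sub>R x) = y}
    = {x. (\<forall>v\<in>S. 0 < L v x) \<and> (\<forall>v\<in>V-S. L v x = 0)}"
proof (intro set_eqI iffI)
  fix x assume "x \<in> {y. \<exists>t. (\<forall>x\<in>S. 0 < t x) \<and> sum t S = 1 \<and> (\<Sum>x\<in>S. t x *\<^sub>R x) = y}"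
  then show "x \<in> {x. (\<forall>v\<in>S. 0 < L v x) \<and> (\<forall>v\<in>V-S. L v x = 0)}"
    using L_combination[OF assms] assms by auto
next
  fix x assume "x \<in> {x. (\<forall>v\<in>S. 0 < L v x) \<and> (\<forall>v\<in>V-S. L v x = 0)}"
  then show "x \<in> {y. \<exists>t. (\<forall>x\<in>S. 0 < t x) \<and> sum t S = 1 \<and> (\<Sum>x\<in>S. t x *\<^sub>R x) = y}"
    using repr_subset[OF assms, of x] by (intro CollectI exI[of _ "\<lambda>v. L v x"]) auto
qed

lemma rel_interior_hull_subset:
  assumes "\<not> affine_dependent V" "S \<subseteq> V"
  shows "rel_interior (convex hull S) = {x. (\<forall>v\<in>S. 0 < L v x) \<and> (\<forall>v\<in>V-S. L v x = 0)}"
  using rel_interior_convex_hull_explicit[OF affine_independent_subset[OF assms]]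
    positive_combinations_eq[OF assms(2)] by simp

lemma interior_hull:
  assumes "\<not> affine_dependent V"
  shows "interior (convex hull V) = {x. \<forall>v\<in>V. 0 < L v x}"
  using interior_convex_hull_explicit_minimal[OF assms] positive_combinations_eq[of V] card_V
  by simp

lemma facet_hull:
  assumes "\<not> affine_dependent V" "v \<in> V"
  shows "convex hull (V - {v}) facet_of convex hull V"
  using facet_of_convex_hull_affine_independent_alt[OF assms(1)] assms(2) card_V
    zero_less_card_finite[where 'a = 'n]
  by (auto simp del: zero_less_card_finite)

end

text \<open>The rescaled gradients \<open>s v\<close> form a facet description, and uniqueness of
  facet descriptions identifies them with \<open>facet_vectors\<close>.\<close>

lemma (in gauge_frame) body_gauge_hull:
  assumes indep: "\<not> affine_dependent V"
  shows "body_gauge f (convex hull V) = \<psi>"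
proof -
  define s where "s v = (- 1 / L v f) *\<^sub>R g v" for v
  have s: "s v \<bullet> x = slope v x" for v x by (simp add: s_def slope_def)
  have le1: "s v \<bullet> (x - f) \<le> 1 \<longleftrightarrow> 0 \<le> L v x" and eq1: "s v \<bullet> (x - f) = 1 \<longleftrightarrow> L v x = 0"
    if "v \<in> V" for v x
    using Lf_pos[OF that] by (auto simp: s slope_to_f that zero_le_divide_iff)
  have hull: "convex hull V = {x. \<forall>v\<in>V. 0 \<le> L v x}"
    using convex_hull_subset_eq[of V] by simp
  have "facet_description f (convex hull V) (s ` V)"
    unfolding facet_description_def
  proof (intro conjI ballI)
    show "finite (s ` V)" using finite_V by simp
    show "convex hull V = {x. \<forall>a\<in>s ` V. a \<bullet> (x - f) \<le> 1}" unfolding hull using le1 by auto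
    fix a assume "a \<in> s ` V"
    then obtain v where v: "v \<in> V" "a = s v" by blast
    have "convex hull (V - {v}) = {x. (\<forall>u\<in>V-{v}. 0 \<le> L u x) \<and> L v x = 0}"
      using convex_hull_subset_eq[of "V - {v}"] v by (simp add: Diff_Diff_Int Int_absorb1)
    then have "{x \<in> convex hull V. a \<bullet> (x - f) = 1} = convex hull (V - {v})"
      unfolding hull using eq1[OF v(1)] v by auto
    then show "{x \<in> convex hull V. a \<bullet> (x - f) = 1} facet_of convex hull V"
      using facet_hull[OF indep v(1)] by simp
  qed
  moreover have "f \<in> interior (convex hull V)" using interior_hull[OF indep] Lf_pos by simp
  ultimately have "facet_vectors f (convex hull V) = s ` V"
    unfolding facet_vectors_def using facet_description_unique by (intro the_equality) blast+
  then show ?thesis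
    by (auto simp: body_gauge_def \<psi>_def image_image s)
qed

section \<open>Unimodular maps and the lattice spanned by the scaled edges\<close>

lemma det_integer:
  assumes "\<forall>i j. (A :: real ^ 'n ^ 'n) $ i $ j \<in> \<int>"
  shows "det A \<in> \<int>"
  unfolding det_def using assms by (intro Ints_sum Ints_mult Ints_prod) auto

lemma affine_unimodular_simplex:
  fixes A :: "real ^ 'n ^ 'n"
  shows "(\<lambda>x. A *v x + t) ` standard_simplex_dilate
    = convex hull (insert t (range (\<lambda>i. real CARD('n) *\<^sub>R column i A + t)))"
proof -
  have "(\<lambda>x. A *v x + t) ` standard_simplex_dilate = (\<lambda>x. t + x) ` ((*v) A) ` standard_simplex_dilate"
    by (simp add: image_image add.commute)
  also have "\<dots> = convex hull ((\<lambda>x. t + x) ` ((*v) A) ` insert 0 (range (\<lambda>i. real CARD('n) *\<^sub>R axis i 1)))"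
    unfolding standard_simplex_dilate_def convex_hull_translation
    by (simp only: convex_hull_linear_image[OF matrix_vector_mul_linear])
  also have "(\<lambda>x. t + x) ` ((*v) A) ` insert 0 (range (\<lambda>i. real CARD('n) *\<^sub>R axis i 1))
      = insert t (range (\<lambda>i. real CARD('n) *\<^sub>R column i A + t))"
    by (simp add: image_image matrix_vector_mult_scaleR matrix_vector_mult_basis add.commute)
  finally show ?thesis .
qed

text \<open>Lattice-freeness makes the vectors \<open>(v - k) / n\<close> a lattice basis: an integer point outside
  their span could be moved into the interior of the simplex.\<close>

lemma (in lattice_simplex) unimodular_if_barycentric:
  assumes bary: "\<And>k l. k \<in> V \<Longrightarrow> l \<in> V \<Longrightarrow> l \<noteq> k \<Longrightarrow> L l (z k) = 1 / real CARD('n)"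
  shows "\<exists>T. affine_unimodular T \<and> convex hull V = T ` standard_simplex_dilate"
proof -
  let ?n = "real CARD('n)"
  have n: "?n > 0" by simp
  obtain k where k: "k \<in> V" using V_nonempty by blast
  have "card (V - {k}) = CARD('n)" using k card_V finite_V by simp
  then obtain h :: "'n \<Rightarrow> real ^ 'n" where h: "bij_betw h UNIV (V - {k})"
    using finite_same_card_bij[of "UNIV :: 'n set" "V - {k}"] finite_V by auto
  have hV: "h j \<in> V" "h j \<noteq> k" for j using h by (auto simp: bij_betw_def)
  have hinj: "h i = h j \<longleftrightarrow> i = j" for i j using h by (auto simp: bij_betw_def inj_on_def)
  have hsurj: "\<exists>j. v = h j" if "v \<in> V" "v \<noteq> k" for v
    using h that by (auto simp: bij_betw_def image_iff set_eq_iff)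
  have z_diff: "z k - z v = (1 / ?n) *\<^sub>R (v - k)" if v: "v \<in> V" "v \<noteq> k" for v
  proof -
    have "z k - z v - (1 / ?n) *\<^sub>R (v - k) = 0"
    proof (rule g_eq_0_imp)
      fix u assume u: "u \<in> V"
      show "g u \<bullet> (z k - z v - (1 / ?n) *\<^sub>R (v - k)) = 0"
        using u v k bary[of k u] bary[of v u] Lz_0
        by (cases "u = k"; cases "u = v") (auto simp: inner_diff_right[of _ "z k - z v"] g_diff L_vertex)
    qed
    then show ?thesis by simp
  qed
  \<comment> \<open>By \<open>z_diff\<close> these scaled edges are differences of the integer
    points \<open>z k\<close> and \<open>z (h j)\<close>.\<close>
  define b where "b j = (1 / ?n) *\<^sub>R (h j - k)" for j
  have b_int: "b j \<in> integer_points" for j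
    unfolding b_def using z_diff[OF hV] z_integer hV k by (metis integer_points_diff)
  have gb: "g (h i) \<bullet> b j = (if i = j then 1 / ?n else 0)" for i j
    using hV k hinj by (auto simp: b_def g_diff L_vertex)
  have span: "\<exists>m :: 'n \<Rightarrow> real. (\<forall>j. m j \<in> \<int>) \<and> x = (\<Sum>j\<in>UNIV. m j *\<^sub>R b j)" if x: "x \<in> integer_points" for x
  proof -
    define y where "y = z k + (x :: real ^ 'n)"
    \<comment> \<open>Ceiling minus one, rather than the floor, reduces each coordinate to the
      interval from 0, excluded, to \<open>1 / ?n\<close>, included; strict positivity is what
      lattice-freeness needs.\<close>
    define m where "m j = real_of_int (\<lceil>?n * L (h j) y\<rceil> - 1)" for j :: 'n
    define y' where "y' = y - (\<Sum>j\<in>UNIV. m j *\<^sub>R b j)"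
    have Lj: "L (h i) y' = L (h i) y - m i / ?n" for i
      by (simp add: y'_def L_diff inner_sum_right gb if_distrib[of "\<lambda>a. m _ * a"] cong: if_cong)
    have range: "0 < L (h i) y'" "L (h i) y' \<le> 1 / ?n" for i
    proof -
      have "m i < ?n * L (h i) y" "?n * L (h i) y \<le> m i + 1"
        unfolding m_def by linarith+
      then have "m i / ?n < L (h i) y" "L (h i) y \<le> (m i + 1) / ?n"
        using n by (simp_all add: pos_divide_less_eq pos_le_divide_eq mult.commute del: of_nat_0_less_iff)
      then show "0 < L (h i) y'" "L (h i) y' \<le> 1 / ?n" by (simp_all add: Lj add_divide_distrib)
    qed
    have y'_int: "y' \<in> integer_points"
      unfolding y'_def y_def m_def using x z_integer k b_int
      by (intro integer_points_diff integer_points_add integer_points_sum integer_points_scaleR) auto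
    obtain v where v: "v \<in> V" "L v y' \<le> 0" using no_interior_integer[OF y'_int] by (auto simp: L_def)
    \<comment> \<open>Only the coordinate at \<open>k\<close> can be nonpositive. The other
      \<open>n\<close> coordinates then sum to at least 1, and since none exceeds
      \<open>1 / ?n\<close>, all equal it.\<close>
    have "v = k" using v range hsurj[of v] by (metis not_less)
    have "(\<Sum>v\<in>V. L v y') = L k y' + (\<Sum>v\<in>V-{k}. L v y')" using finite_V k by (rule sum.remove)
    also have "(\<Sum>v\<in>V-{k}. L v y') = (\<Sum>j\<in>UNIV. L (h j) y')"
      using sum.reindex_bij_betw[OF h, of "\<lambda>v. L v y'"] by simp
    finally have ge: "1 \<le> (\<Sum>j\<in>UNIV. L (h j) y')" using v \<open>v = k\<close> by (simp add: sum_L)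
    have "(\<Sum>j\<in>UNIV. 1 / ?n - L (h j) y') = 1 - (\<Sum>j\<in>UNIV. L (h j) y')"
      by (simp add: sum_subtractf)
    then have "(\<Sum>j\<in>UNIV. 1 / ?n - L (h j) y') \<le> 0" using ge by simp
    moreover have "0 \<le> (\<Sum>j\<in>UNIV. 1 / ?n - L (h j) y')" using range by (intro sum_nonneg) simp
    ultimately have "(\<Sum>j\<in>UNIV. 1 / ?n - L (h j) y') = 0" by simp
    then have all: "L (h j) y' = 1 / ?n" for j
      using range sum_nonneg_eq_0_iff[of UNIV "\<lambda>j. 1 / ?n - L (h j) y'"] by auto
    have "y' = z k"
    proof (rule eq_z[OF k y'_int])
      show "0 < L u y'" if "u \<in> V" "u \<noteq> k" for u using hsurj[OF that] range by auto
      have "(\<Sum>v\<in>V-{k}. L v y') = 1"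
        using sum.reindex_bij_betw[OF h, of "\<lambda>v. L v y'"] all by simp
      then show "L k y' = 0" using sum.remove[OF finite_V k, of "\<lambda>v. L v y'"] by (simp add: sum_L)
    qed
    then have "x = (\<Sum>j\<in>UNIV. m j *\<^sub>R b j)" by (simp add: y'_def y_def)
    moreover have "\<forall>j. m j \<in> \<int>" by (simp add: m_def)
    ultimately show ?thesis by blast
  qed
  define A :: "real ^ 'n ^ 'n" where "A = (\<chi> i j. b j $ i)"
  have colA: "column j A = b j" for j by (simp add: A_def column_def vec_eq_iff)
  have A_int: "\<forall>i j. A $ i $ j \<in> \<int>" using b_int by (simp add: A_def integer_points_def)
  \<comment> \<open>Expressing the unit vectors in the \<open>b j\<close> gives an integer right
    inverse of \<open>A\<close>, so two integer determinants multiply to 1.\<close>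
  have "\<exists>m. \<forall>i. (\<forall>j. m i j \<in> \<int>) \<and> axis i 1 = (\<Sum>j\<in>UNIV. m i j *\<^sub>R b j)"
    using span by (intro choice) (auto simp: integer_points_def axis_def)
  then obtain m where m: "\<And>i j. m i j \<in> \<int>" "\<And>i. axis i 1 = (\<Sum>j\<in>UNIV. m i j *\<^sub>R b j)" by blast
  define M :: "real ^ 'n ^ 'n" where "M = (\<chi> j i. m i j)"
  have "A ** M = mat 1"
  proof -
    have "(A ** M) $ r $ i = (mat 1 :: real ^ 'n ^ 'n) $ r $ i" for r i
    proof -
      have "(A ** M) $ r $ i = (\<Sum>j\<in>UNIV. m i j *\<^sub>R b j) $ r"
        by (simp add: matrix_matrix_mult_def A_def M_def mult.commute)
      also have "\<dots> = axis i 1 $ r" using m(2) by metis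
      finally show ?thesis by (simp add: axis_def mat_def)
    qed
    then show ?thesis by (simp add: vec_eq_iff)
  qed
  then have "det A * det M = 1" by (metis det_I det_mul)
  moreover obtain da dm where "det A = of_int da" "det M = of_int dm"
    using det_integer[OF A_int] det_integer[of M] m(1) by (auto simp: M_def elim!: Ints_cases)
  ultimately have "real_of_int (da * dm) = 1" and da: "det A = of_int da" by simp_all
  then have "da * dm = 1" by linarith
  then have "da = 1 \<or> da = - 1" by (auto simp: zmult_eq_1_iff)
  then have detA: "det A = 1 \<or> det A = - 1" using da by auto
  have k_int: "k \<in> integer_points"
  proof -
    have "z k = k + (\<Sum>j\<in>UNIV. b j)"
    proof (rule L_ext)
      fix v assume v: "v \<in> V"
      show "L v (z k) = L v (k + (\<Sum>j\<in>UNIV. b j))"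
      proof (cases "v = k")
        case True
        have "g k \<bullet> b j = - 1 / ?n" for j using hV k by (simp add: b_def g_diff L_vertex)
        then show ?thesis using True k by (simp add: L_add inner_sum_right L_vertex Lz_0)
      next
        case False
        then obtain i where "v = h i" using hsurj v by blast
        then show ?thesis using k v False bary[OF k v] by (simp add: L_add inner_sum_right L_vertex gb)
      qed
    qed
    then have "k = z k - (\<Sum>j\<in>UNIV. b j)" by simp
    also have "\<dots> \<in> integer_points" using z_integer k b_int by auto
    finally show ?thesis .
  qed
  let ?T = "\<lambda>x. A *v x + k"
  have "affine_unimodular ?T" unfolding affine_unimodular_def using A_int detA k_int by blast
  moreover have "insert k (range (\<lambda>i. ?n *\<^sub>R column i A + k)) = V"
  proof -
    have "?n *\<^sub>R column i A + k = h i" for i using n by (simp add: colA b_def)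
    then have "range (\<lambda>i. ?n *\<^sub>R column i A + k) = range h" by simp
    also have "\<dots> = V - {k}" using h by (simp add: bij_betw_def)
    finally show ?thesis using k by auto
  qed
  ultimately show ?thesis using affine_unimodular_simplex[of A k] by metis
qed

text \<open>Vertices of an affinely independent set are extreme points of its hull, hence occur
  among the images of the generators of the standard simplex. All of these are congruent to
  \<open>t\<close> modulo \<open>n\<close> times the lattice.\<close>

lemma divisible_vertices_if_unimodular:
  fixes V :: "(real ^ 'n) set"
  assumes indep: "\<not> affine_dependent V"
    and T: "affine_unimodular T" "convex hull V = T ` standard_simplex_dilate"
  shows "V \<subseteq> integer_points"
    and "\<And>u v. u \<in> V \<Longrightarrow> v \<in> V \<Longrightarrow> (1 / real CARD('n)) *\<^sub>R (u - v) \<in> integer_points"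
proof -
  let ?n = "real CARD('n)"
  obtain A :: "real ^ 'n ^ 'n" and t where A: "\<forall>i j. A $ i $ j \<in> \<int>" "t \<in> integer_points"
      "T = (\<lambda>x. A *v x + t)"
    using T(1) unfolding affine_unimodular_def by blast
  have col: "column i A \<in> integer_points" for i
    using A(1) by (simp add: column_def integer_points_def)
  have hull: "convex hull V = convex hull (insert t (range (\<lambda>i. ?n *\<^sub>R column i A + t)))"
    using T(2) affine_unimodular_simplex[of A t] A(3) by simp
  have "\<exists>a\<in>integer_points. v = ?n *\<^sub>R a + t" if v: "v \<in> V" for v
  proof -
    have "v extreme_point_of convex hull V"
      using extreme_point_of_convex_hull_affine_independent[OF indep] v by simp
    then have "v \<in> insert t (range (\<lambda>i. ?n *\<^sub>R column i A + t))"
      unfolding hull by (rule extreme_point_of_convex_hull)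
    then show ?thesis
    proof
      assume "v = t"
      then show ?thesis by (intro bexI[of _ 0]) auto
    qed (use col in blast)
  qed
  then obtain a where a: "\<And>v. v \<in> V \<Longrightarrow> a v \<in> integer_points \<and> v = ?n *\<^sub>R a v + t" by metis
  show "V \<subseteq> integer_points"
  proof
    fix v assume "v \<in> V"
    then have "a v \<in> integer_points" and v: "v = ?n *\<^sub>R a v + t" using a by blast+
    then have "?n *\<^sub>R a v + t \<in> integer_points"
      using A(2) by (intro integer_points_add integer_points_scaleR) simp_all
    with v show "v \<in> integer_points" by metis
  qed
  show "(1 / ?n) *\<^sub>R (u - v) \<in> integer_points" if "u \<in> V" "v \<in> V" for u v
  proof -
    have "u - v = ?n *\<^sub>R (a u - a v)" using a that by (metis add_diff_cancel_right scaleR_diff_right)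
    then have "(1 / ?n) *\<^sub>R (u - v) = a u - a v" by simp
    also have "\<dots> \<in> integer_points" using a that by blast
    finally show ?thesis .
  qed
qed

theorem theorem2:
  fixes \<Delta> :: "(real ^ 'n) set"
  assumes "CARD('n) \<ge> 2"
    and "int CARD('n) simplex \<Delta>"
    and "maximal_lattice_free_body \<Delta>"
    and "\<And>F. F facet_of \<Delta> \<Longrightarrow> \<exists>!z. z \<in> rel_interior F \<inter> integer_points"
  shows "unique_lifting_for_all_f \<Delta> \<longleftrightarrow>
    (\<exists>T. affine_unimodular T \<and> \<Delta> = T ` standard_simplex_dilate)"
proof -
  obtain V where V: "\<not> affine_dependent V" "int (card V) = int CARD('n) + 1" "\<Delta> = convex hull V"
    using assms(2) by (auto simp: simplex_def)
  then have "card V = CARD('n) + 1" by simp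
  then obtain g c where "affine_frame V g c" using exists_affine_frame V(1) by blast
  then interpret affine_frame V g c .
  have "interior \<Delta> \<inter> integer_points = {}"
    using assms(3) by (simp add: maximal_lattice_free_body_def maximal_lattice_free_def lattice_free_def)
  then have free: "\<exists>v\<in>V. L v w \<le> 0" if "w \<in> integer_points" for w
    using interior_hull[OF V(1)] that V(3) by (force simp: not_le[symmetric])
  have facet: "rel_interior (convex hull (V - {v})) = {x. (\<forall>u\<in>V-{v}. 0 < L u x) \<and> L v x = 0}"
    if "v \<in> V" for v
    using rel_interior_hull_subset[OF V(1), of "V - {v}"] that by (simp add: Diff_Diff_Int Int_absorb1)
  \<comment> \<open>By \<open>facet\<close> these are the integer points in the relative interior of
    the facet opposite to \<open>v\<close>, so the hypothesis on facets makes the choice of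
    \<open>z v\<close> well defined.\<close>
  define G where "G v = {x. (\<forall>u\<in>V-{v}. 0 < L u x) \<and> L v x = 0} \<inter> integer_points" for v
  have ex1: "\<exists>!y. y \<in> G v" if "v \<in> V" for v
    unfolding G_def
    using assms(4)[of "convex hull (V - {v})"] facet_hull[OF V(1) that] facet[OF that] V(3) by simp
  define z where "z v = (THE y. y \<in> G v)" for v
  have z: "z v \<in> G v" if "v \<in> V" for v
    unfolding z_def using ex1[OF that] by (rule theI')
  have z_eq: "w = z v" if "v \<in> V" "w \<in> G v" for v w
    unfolding z_def using the1_equality[OF ex1] that by metis
  interpret lattice_simplex V g c z
    by unfold_locales (use free z z_eq in \<open>auto simp: L_def G_def\<close>)
  have frame: "gauge_frame V g c f" if "\<forall>v\<in>V. 0 < L v f" for f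
    by unfold_locales (use free that in \<open>auto simp: L_def\<close>)
  have gauge: "body_gauge f \<Delta> = gauge_frame.\<psi> V g c f" if "\<forall>v\<in>V. 0 < L v f" for f
    using gauge_frame.body_gauge_hull[OF frame[OF that] V(1)] V(3) by simp
  have int: "f \<in> interior \<Delta> \<longleftrightarrow> (\<forall>v\<in>V. 0 < L v f)" for f
    using interior_hull[OF V(1)] V(3) by simp
  show ?thesis
  proof
    assume uniq: "unique_lifting_for_all_f \<Delta>"
    have gauge_uniq: "\<exists>!\<pi>. minimal_lifting f (gauge_frame.\<psi> V g c f) \<pi>"
      if pos: "\<forall>v\<in>V. 0 < L v f" for f
    proof -
      have "f \<in> interior \<Delta>" using int pos by blast
      then have "\<exists>!\<pi>. minimal_lifting f (body_gauge f \<Delta>) \<pi>"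
        using uniq unfolding unique_lifting_for_all_f_def by (rule bspec[rotated])
      then show ?thesis unfolding gauge[OF pos] .
    qed
    show "\<exists>T. affine_unimodular T \<and> \<Delta> = T ` standard_simplex_dilate"
      unfolding V(3) by (intro unimodular_if_barycentric facet_points_barycentric gauge_uniq)
  next
    assume "\<exists>T. affine_unimodular T \<and> \<Delta> = T ` standard_simplex_dilate"
    then obtain T where T: "affine_unimodular T" "convex hull V = T ` standard_simplex_dilate"
      using V(3) by auto
    show "unique_lifting_for_all_f \<Delta>"
      unfolding unique_lifting_for_all_f_def
    proof
      fix f assume "f \<in> interior \<Delta>"
      then have pos: "\<forall>v\<in>V. 0 < L v f" using int by blast
      interpret gauge_frame V g c f using pos by (rule frame)
      show "\<exists>!\<pi>. minimal_lifting f (body_gauge f \<Delta>) \<pi>"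
        unfolding gauge[OF pos]
        using divisible_vertices_if_unimodular[OF V(1) T]
        by (intro unique_minimal_lifting_if_covered covered_if_divisible) auto
    qed
  qed
qed

end
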